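(* Let the setting be as in the context, with $0<\sigma<\infty$. Let the constitutive law $\mathbf D=\mathcal A(|\mathbf E|)\mathbf E$ be of series of $p$-Laplacian type, i.e. $\mathcal A(t)=\sum_{p\ge2}a_pt^{p-2}$, with maximal displacement $\Lambda<\infty$. Then a charge density $\rho\in L^1(\Omega)$ admits an electrostatic potential with $|\mathbf E|\le\sigma$ in $\Omega$ only if $$\Big|\int_E\rho\Big|\le\Lambda\,P(E)\qquad\text{for every set of finite perimeter }E\Subset\Omega .$$ In particular a uniform density $\rho$ in a ball of radius $R$ is admissible only for $\rho\le N\Lambda/R$, i.e. the total charge enclosed by a surface cannot exceed $\Lambda$ times its area.
   Context: $\Omega\subset\mathbb{R}^N$ ($N\ge1$) is a bounded, connected, open set with Lipschitz boundary. $\{a_p\}_{p\ge2}$ ($p$ integer) is a real sequence with $a_p\ge0$ for all $p$, $a_2>0$, and $a_p\ne0$ for infinitely many $p$; $\sigma$ (maximal field strength) is defined by $1/\sigma=\limsup_{p\to\infty}a_p^{1/p}$, and $\Lambda=\sum_{p\ge2}a_p\sigma^{p-1}\in(0,+\infty]$ is the maximal displacement. $P(E)$ is the perimeter of $E$ in $\mathbb{R}^N$. The potential $u$, the electric field $\mathbf E=-\nabla u$ and the electric displacement $\mathbf D=\mathcal A(|\mathbf E|)\mathbf E$ are related by Gauss' law $\operatorname{div}\mathbf D=\rho$, i.e. $-\sum_{p\ge2}a_p\Delta_pu=\rho$ with $\Delta_pu=\operatorname{div}(|\nabla u|^{p-2}\nabla u)$. Precisely, $\rho$ admits an electrostatic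 potential with $|\mathbf E|\le\sigma$ in $\Omega$ ("$\rho$ is admissible") if there is $u\in C^{0,1}(\overline\Omega)$ with $\|\nabla u\|_{L^\infty(\Omega)}\le\sigma$ (with some boundary values $g\in C^{0,1}(\partial\Omega)$) such that $\sum_{p\ge2}a_p\int_\Omega|\nabla u|^{p-2}\nabla u\cdot\nabla\psi=\int_\Omega\rho\psi$ for every $\psi\in W^{1,\infty}_0(\Omega)$ (Lipschitz functions on $\overline\Omega$ vanishing on $\partial\Omega$); the series converges absolutely when $\Lambda<\infty$. In the "in particular" part, the ball $B_R$ is contained in $\Omega$ (possibly $\Omega=B_R$) and the density equals the constant $\rho\ge0$ in $B_R$. *)

theory Defs
  imports "HOL-Analysis.Analysis"
begin

section \<open>Lipschitz domains\<close>

text \<open>Near each boundary point, the set is the strict epigraph, in some unit direction \<open>e\<close>, of a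
  Lipschitz function \<open>\<gamma>\<close> on the hyperplane orthogonal to \<open>e\<close>; the point \<open>y - (y \<bullet> e) e\<close> is the
  projection of \<open>y\<close> to that hyperplane.\<close>

definition lipschitz_boundary :: "'a::euclidean_space set \<Rightarrow> bool" where
  "lipschitz_boundary \<Omega> \<longleftrightarrow>
     (\<forall>x\<in>frontier \<Omega>. \<exists>r>0. \<exists>e \<gamma> L. norm e = 1 \<and> L-lipschitz_on {z. z \<bullet> e = 0} \<gamma> \<and>
        \<Omega> \<inter> ball x r = {y \<in> ball x r. \<gamma> (y - (y \<bullet> e) *\<^sub>R e) < y \<bullet> e})"

definition bounded_lipschitz_domain :: "'a::euclidean_space set \<Rightarrow> bool" where
  "bounded_lipschitz_domain \<Omega> \<longleftrightarrow>
     bounded \<Omega> \<and> connected \<Omega> \<and> open \<Omega> \<and> lipschitz_boundary \<Omega>"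

definition lipschitz_fun_on :: "'a::euclidean_space set \<Rightarrow> ('a \<Rightarrow> real) \<Rightarrow> bool" where
  "lipschitz_fun_on S f \<longleftrightarrow> (\<exists>L. L-lipschitz_on S f)"

section \<open>Perimeter\<close>

definition C1_compact_support :: "('a::euclidean_space \<Rightarrow> 'a) \<Rightarrow> bool" where
  "C1_compact_support \<phi> \<longleftrightarrow>
     (\<exists>\<phi>' :: 'a \<Rightarrow> 'a \<Rightarrow>\<^sub>L 'a. (\<forall>x. (\<phi> has_derivative blinfun_apply (\<phi>' x)) (at x)) \<and>
        continuous_on UNIV \<phi>') \<and>
     compact (closure {x. \<phi> x \<noteq> 0})"

definition divergence :: "('a::euclidean_space \<Rightarrow> 'a) \<Rightarrow> 'a \<Rightarrow> real" where
  "divergence \<phi> x = (\<Sum>b\<in>Basis. frechet_derivative \<phi> (at x) b \<bullet> b)"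

text \<open>The total variation on the whole space of the distributional gradient of the indicator
  function of \<open>E\<close>; only meaningful for Lebesgue measurable \<open>E\<close>.\<close>

definition perimeter :: "'a::euclidean_space set \<Rightarrow> ereal" where
  "perimeter E =
     (SUP \<phi> \<in> {\<phi>. C1_compact_support \<phi> \<and> (\<forall>x. norm (\<phi> x) \<le> 1)}.
        ereal (LINT x:E|lebesgue. divergence \<phi> x))"

definition finite_perimeter :: "'a::euclidean_space set \<Rightarrow> bool" where
  "finite_perimeter E \<longleftrightarrow> E \<in> sets lebesgue \<and> perimeter E < \<infinity>"

definition compactly_contained :: "'a::euclidean_space set \<Rightarrow> 'a set \<Rightarrow> bool" where
  "compactly_contained E \<Omega> \<longleftrightarrow> compact (closure E) \<and> closure E \<subseteq> \<Omega>"

section \<open>Constitutive laws of series of p-Laplacian type\<close>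

text \<open>The coefficients are \<open>a p\<close> for \<open>p \<ge> 2\<close>, and the law is
  \<open>D = (\<Sum>p\<ge>2. a p |E| ^ (p - 2)) E\<close>. The values \<open>a 0\<close> and \<open>a 1\<close> play no role. Series over
  \<open>p \<ge> 2\<close> are written as series over all natural numbers with \<open>p\<close> replaced by \<open>p + 2\<close>.\<close>

definition admissible_coeffs :: "(nat \<Rightarrow> real) \<Rightarrow> bool" where
  "admissible_coeffs a \<longleftrightarrow>
     (\<forall>p\<ge>2. 0 \<le> a p) \<and> 0 < a 2 \<and> infinite {p. 2 \<le> p \<and> a p \<noteq> 0}"

definition max_field_strength :: "(nat \<Rightarrow> real) \<Rightarrow> ereal" where
  "max_field_strength a = 1 / limsup (\<lambda>p. ereal (root p (a p)))"

definition max_displacement :: "(nat \<Rightarrow> real) \<Rightarrow> real \<Rightarrow> ereal" where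
  "max_displacement a \<sigma> = (\<Sum>p. ereal (a (p + 2) * \<sigma> ^ (p + 1)))"

section \<open>Admissible charge densities\<close>

text \<open>The pointwise gradient, set to \<open>0\<close> where the function is not differentiable. By
  Rademacher's theorem the latter happens only on a null set for Lipschitz functions, so this
  represents their weak gradient.\<close>

definition grad :: "('a::euclidean_space \<Rightarrow> real) \<Rightarrow> 'a \<Rightarrow> 'a" where
  "grad u x = (if \<exists>D. GDERIV u x :> D then (THE D. GDERIV u x :> D) else 0)"

definition test_function :: "'a::euclidean_space set \<Rightarrow> ('a \<Rightarrow> real) \<Rightarrow> bool" where
  "test_function \<Omega> \<psi> \<longleftrightarrow>
     lipschitz_fun_on (closure \<Omega>) \<psi> \<and> (\<forall>x\<in>frontier \<Omega>. \<psi> x = 0)"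

text \<open>The electric field is \<open>E = - grad u\<close>. The last clause is the weak form of Gauss' law
  \<open>- (\<Sum>p\<ge>2. a p \<Delta>\<^sub>p u) = \<rho>\<close>.\<close>

definition electrostatic_potential ::
  "(nat \<Rightarrow> real) \<Rightarrow> real \<Rightarrow> 'a::euclidean_space set \<Rightarrow> ('a \<Rightarrow> real) \<Rightarrow> ('a \<Rightarrow> real) \<Rightarrow> ('a \<Rightarrow> real) \<Rightarrow> bool"
where
  "electrostatic_potential a \<sigma> \<Omega> \<rho> g u \<longleftrightarrow>
     lipschitz_fun_on (closure \<Omega>) u \<and>
     (\<forall>x\<in>frontier \<Omega>. u x = g x) \<and>
     (AE x\<in>\<Omega> in lebesgue. norm (grad u x) \<le> \<sigma>) \<and>
     (\<forall>\<psi>. test_function \<Omega> \<psi> \<longrightarrow>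
        (\<lambda>p. a (p + 2) *
            (LINT x:\<Omega>|lebesgue. norm (grad u x) ^ p * (grad u x \<bullet> grad \<psi> x)))
          sums (LINT x:\<Omega>|lebesgue. \<rho> x * \<psi> x))"

definition admissible_density ::
  "(nat \<Rightarrow> real) \<Rightarrow> real \<Rightarrow> 'a::euclidean_space set \<Rightarrow> ('a \<Rightarrow> real) \<Rightarrow> bool" where
  "admissible_density a \<sigma> \<Omega> \<rho> \<longleftrightarrow>
     (\<exists>g u. lipschitz_fun_on (frontier \<Omega>) g \<and> electrostatic_potential a \<sigma> \<Omega> \<rho> g u)"

end

theory Submission
  imports Defs
begin

text \<open>Since \<open>|\<nabla>u| \<le> \<sigma>\<close>, testing Gauss' law with \<open>\<psi>\<close> bounds \<open>|\<integral> \<rho> \<psi>|\<close> by \<open>\<Lambda> \<integral> |\<nabla>\<psi>|\<close>, because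
  the \<open>p\<close>-th term of the series is at most \<open>a\<^sub>p \<sigma>\<^bsup>p-1\<^esup> \<integral> |\<nabla>\<psi>|\<close>. For a set \<open>E\<close> one takes \<open>\<psi>\<close> to be
  a mollified indicator function: \<open>\<integral> |\<nabla>\<psi>|\<close> is at most the perimeter of \<open>E\<close>, and \<open>\<psi>\<close> converges
  to the indicator function almost everywhere along a subsequence, so that \<open>\<integral> \<rho> \<psi>\<close> converges to the charge of \<open>E\<close>.
  A ball may touch the boundary of the domain, so there one uses the radial cutoff that is \<open>1\<close> on
  the ball of radius \<open>(1 - s) R\<close> and \<open>0\<close> outside the ball of radius \<open>R\<close>, and lets \<open>s\<close> tend to \<open>0\<close>;
  the lower bound \<open>N |B\<^sub>R| / R\<close> for the perimeter of the ball comes from mollifying the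
  field \<open>(x - x0) / (R + \<epsilon>)\<close>.\<close>

section \<open>Mollifiers\<close>

text \<open>The quotient in the definition of the derivative is at most \<open>C * norm h\<close>,
  which tends to 0. This form serves both the squared positive part below and mollified functions,
  where a Taylor bound for the kernel is integrated.\<close>

lemma has_derivative_at_if_quadratic_remainder:
  fixes f :: "'a::real_normed_vector \<Rightarrow> 'b::real_normed_vector"
  assumes D: "bounded_linear D"
    and rem: "\<And>h. norm (f (x + h) - f x - D h) \<le> C * (norm h)\<^sup>2"
  shows "(f has_derivative D) (at x)"
  unfolding has_derivative_at
proof (intro conjI D)
  have lim: "((\<lambda>h. C * norm h) \<longlongrightarrow> 0) (at (0::'a))"
    by (intro tendsto_mult_right_zero tendsto_norm_zero tendsto_ident_at)
  show "(\<lambda>h. norm (f (x + h) - f x - D h) / norm h) \<midarrow>0\<rightarrow> 0"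
  proof (rule Lim_null_comparison[OF _ lim])
    show "\<forall>\<^sub>F h in at 0. norm (norm (f (x + h) - f x - D h) / norm h) \<le> C * norm h"
    proof (rule eventually_mono[OF eventually_at_ball'[of 1]])
      fix h :: 'a assume "h \<in> ball 0 1 \<and> h \<noteq> 0 \<and> h \<in> UNIV"
      then show "norm (norm (f (x + h) - f x - D h) / norm h) \<le> C * norm h"
        using rem[of h] by (simp add: divide_le_eq power2_eq_square mult.assoc)
    qed simp
  qed
qed

section \<open>An explicit C^1 kernel with Lipschitz gradient, supported in the closed ball of
  radius \<open>e\<close>\<close>

definition bump :: "real \<Rightarrow> 'a::euclidean_space \<Rightarrow> real" where
  "bump e z = (max 0 (e\<^sup>2 - z \<bullet> z))\<^sup>2"

definition bump_grad :: "real \<Rightarrow> 'a::euclidean_space \<Rightarrow> 'a" where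
  "bump_grad e z = (- 4 * max 0 (e\<^sup>2 - z \<bullet> z)) *\<^sub>R z"

text \<open>Squaring removes the kink of the positive part: when \<open>t\<close> and
  \<open>t + h\<close> have the same sign, the remainder is 0 or the square of \<open>h\<close>. The
  facts \<open>*\<close> and \<open>**\<close> treat opposite signs, where \<open>t + h\<close> is
  no larger than \<open>h\<close> in absolute value.\<close>

lemma max_square_has_real_derivative:
  "((\<lambda>t::real. (max 0 t)\<^sup>2) has_real_derivative 2 * max 0 t) (at t)"
  unfolding has_field_derivative_def
proof (rule has_derivative_at_if_quadratic_remainder[where C = 1])
  fix h :: real
  have *: "\<bar>h * h + 2 * (t * h) + t * t\<bar> \<le> h * h" if "t \<le> 0" "0 \<le> t + h"
  proof -
    have "(t + h) * (t + h) \<le> h * h"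
      using that by (intro mult_mono) auto
    moreover have "0 \<le> (t + h) * (t + h)" by simp
    ultimately show ?thesis by (simp add: algebra_simps)
  qed
  have **: "\<bar>t * t + 2 * (t * h)\<bar> \<le> h * h" if "0 \<le> t" "t + h \<le> 0"
  proof -
    have "(t + h) * (t + h) \<le> h * h"
      using that abs_le_square_iff[of "t + h" h] by (simp add: power2_eq_square)
    moreover have "0 \<le> (t + h) * (t + h)" by simp
    moreover have "t * (t + h) \<le> 0" using that by (simp add: mult_nonneg_nonpos)
    moreover have "t * h \<le> 0" using that by (simp add: mult_nonneg_nonpos)
    ultimately show ?thesis by (simp add: algebra_simps abs_if)
  qed
  show "norm ((max 0 (t + h))\<^sup>2 - (max 0 t)\<^sup>2 - 2 * max 0 t * h) \<le> 1 * (norm h)\<^sup>2"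
    using * ** by (cases "t \<le> 0"; cases "t + h \<le> 0")
      (auto simp: max_def power2_eq_square algebra_simps)
qed (simp add: bounded_linear_mult_right)

lemma bump_has_derivative:
  "(bump e has_derivative (\<lambda>h. bump_grad e z \<bullet> h)) (at z)"
proof -
  have "((\<lambda>z. e\<^sup>2 - z \<bullet> z) has_derivative (\<lambda>h. - (z \<bullet> h + h \<bullet> z))) (at z)"
    by (auto intro!: derivative_eq_intros)
  from has_derivative_compose[OF this max_square_has_real_derivative[unfolded has_field_derivative_def]]
  show ?thesis
    unfolding bump_def[abs_def]
    by (rule has_derivative_eq_rhs) (simp add: bump_grad_def fun_eq_iff inner_commute algebra_simps)
qed

lemma norm_bump_grad_le:
  assumes "0 \<le> e"
  shows "norm (bump_grad e z) \<le> 4 * e ^ 3"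
proof (cases "norm z \<le> e")
  case True
  then have "0 \<le> e\<^sup>2 - z \<bullet> z"
    by (simp add: power2_norm_eq_inner[symmetric] power_mono)
  moreover have "(e\<^sup>2 - z \<bullet> z) * norm z \<le> e\<^sup>2 * e"
    using True assms calculation by (intro mult_mono) auto
  moreover have "norm (bump_grad e z) = 4 * ((e\<^sup>2 - z \<bullet> z) * norm z)"
    using \<open>0 \<le> e\<^sup>2 - z \<bullet> z\<close> by (simp add: bump_grad_def abs_mult)
  ultimately show ?thesis
    by (simp add: power2_eq_square power3_eq_cube mult.assoc)
next
  case False
  then have "e\<^sup>2 \<le> z \<bullet> z"
    using assms by (simp add: power2_norm_eq_inner[symmetric] power_mono)
  then show ?thesis using assms by (simp add: bump_grad_def max_def)
qed

lemma bump_grad_eq_0: "0 \<le> e \<Longrightarrow> e \<le> norm z \<Longrightarrow> bump_grad e z = 0"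
  by (simp add: bump_grad_def power2_norm_eq_inner[symmetric] power_mono max_def)

text \<open>For two points of the ball, the difference is split into a multiple of
  \<open>z - w\<close> and a multiple of \<open>w\<close>; the two parts contribute e^2 and 2 e^2,
  and the factor 4 of \<open>bump_grad\<close> turns their sum into 12 e^2. For one point inside and
  one outside, the gradient vanishes at the outer point and \<open>e - norm z\<close> is at most
  \<open>norm (z - w)\<close>.\<close>

lemma bump_grad_lipschitz:
  fixes z w :: "'a::euclidean_space"
  assumes "0 \<le> e"
  shows "norm (bump_grad e z - bump_grad e w) \<le> 12 * e\<^sup>2 * norm (z - w)"
proof -
  have in_in: "norm (bump_grad e z - bump_grad e w) \<le> 12 * e\<^sup>2 * norm (z - w)"
    if z: "norm z \<le> e" and w: "norm w \<le> e" for z w :: 'a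
  proof -
    have nz: "0 \<le> e\<^sup>2 - z \<bullet> z" and nw: "0 \<le> e\<^sup>2 - w \<bullet> w"
      using z w by (simp_all add: power2_norm_eq_inner[symmetric] power_mono)
    have eq: "bump_grad e z - bump_grad e w
        = (-4) *\<^sub>R ((e\<^sup>2 - z \<bullet> z) *\<^sub>R (z - w) + (w \<bullet> w - z \<bullet> z) *\<^sub>R w)"
      using nz nw by (simp add: bump_grad_def algebra_simps)
    have "\<bar>w \<bullet> w - z \<bullet> z\<bar> = \<bar>norm w - norm z\<bar> * (norm w + norm z)"
      by (simp add: power2_norm_eq_inner[symmetric] power2_eq_square square_diff_square_factored abs_mult)
    also have "\<dots> \<le> norm (z - w) * (2 * e)"
      using z w by (intro mult_mono) (auto simp: norm_triangle_ineq3 norm_minus_commute)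
    finally have "\<bar>w \<bullet> w - z \<bullet> z\<bar> * norm w \<le> norm (z - w) * (2 * e) * e"
      using w assms by (intro mult_mono) auto
    moreover have "(e\<^sup>2 - z \<bullet> z) * norm (z - w) \<le> e\<^sup>2 * norm (z - w)"
      by (intro mult_right_mono) auto
    ultimately have "norm ((e\<^sup>2 - z \<bullet> z) *\<^sub>R (z - w) + (w \<bullet> w - z \<bullet> z) *\<^sub>R w) \<le> 3 * e\<^sup>2 * norm (z - w)"
      using nz by (intro order_trans[OF norm_triangle_ineq]) (simp add: power2_eq_square mult.commute mult.left_commute)
    then show ?thesis unfolding eq norm_scaleR by (simp add: ac_simps)
  qed
  have in_out: "norm (bump_grad e z) \<le> 12 * e\<^sup>2 * norm (z - w)"
    if z: "norm z \<le> e" and w: "e \<le> norm w" for z w :: 'a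
  proof -
    have nz: "0 \<le> e\<^sup>2 - z \<bullet> z"
      using z by (simp add: power2_norm_eq_inner[symmetric] power_mono)
    have "norm (bump_grad e z) = 4 * ((e\<^sup>2 - z \<bullet> z) * norm z)"
      using nz by (simp add: bump_grad_def abs_mult)
    also have "e\<^sup>2 - z \<bullet> z = (e - norm z) * (e + norm z)"
      by (simp add: power2_norm_eq_inner[symmetric] power2_eq_square algebra_simps)
    also have "(e - norm z) * (e + norm z) * norm z \<le> norm (z - w) * (2 * e) * e"
    proof (intro mult_mono)
      show "e - norm z \<le> norm (z - w)"
        using w norm_triangle_ineq3[of z w] by linarith
    qed (use z assms in auto)
    finally show ?thesis
      using mult_nonneg_nonneg[of "norm (z - w)" "e * e"] by (simp add: power2_eq_square algebra_simps)
  qed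
  show ?thesis
  proof (cases "norm z \<le> e"; cases "norm w \<le> e")
    assume "norm z \<le> e" "norm w \<le> e" then show ?thesis by (rule in_in)
  next
    assume "norm z \<le> e" "\<not> norm w \<le> e"
    then show ?thesis using in_out[of z w] bump_grad_eq_0[OF assms, of w] by simp
  next
    assume "\<not> norm z \<le> e" "norm w \<le> e"
    then show ?thesis using in_out[of w z] bump_grad_eq_0[OF assms, of z]
      by (simp add: norm_minus_commute)
  next
    assume "\<not> norm z \<le> e" "\<not> norm w \<le> e"
    then show ?thesis using bump_grad_eq_0[OF assms, of w] bump_grad_eq_0[OF assms, of z] by simp
  qed
qed

lemma continuous_on_bump: "continuous_on UNIV (bump e)"
  unfolding bump_def by (intro continuous_intros)

lemma bump_eq_0: "0 \<le> e \<Longrightarrow> e \<le> norm z \<Longrightarrow> bump e z = 0"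
  by (simp add: bump_def power2_norm_eq_inner[symmetric] power_mono max_def)

lemma bump_pos: "norm z < e \<Longrightarrow> 0 < bump e z"
  using power_strict_mono[of "norm z" e 2] by (simp add: bump_def power2_norm_eq_inner[symmetric])

lemma bump_nonneg: "0 \<le> bump e z"
  by (simp add: bump_def)

lemma bump_le: "bump e z \<le> e ^ 4"
proof -
  have "max 0 (e\<^sup>2 - z \<bullet> z) \<le> e\<^sup>2" by simp
  then have "bump e z \<le> (e\<^sup>2)\<^sup>2"
    unfolding bump_def by (intro power_mono) auto
  then show ?thesis by (simp flip: power_mult)
qed

lemma integrable_bounded_support:
  fixes f :: "'a::euclidean_space \<Rightarrow> 'b::{banach,second_countable_topology}"
  assumes "f \<in> borel_measurable borel" "bounded S" "\<And>x. x \<notin> S \<Longrightarrow> f x = 0" "\<And>x. norm (f x) \<le> B"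
  shows "integrable lborel f"
proof -
  obtain r where r: "S \<subseteq> cball 0 r"
    using bounded_subset_ballD[OF assms(2), of 0] ball_subset_cball by blast
  have "integrable lborel (\<lambda>x. B * indicator (cball 0 r :: 'a set) x :: real)"
    using emeasure_lborel_cball_finite[of "0::'a" r] by (intro integrable_mult_right) (simp add: integrable_indicator_iff)
  then show ?thesis
  proof (rule Bochner_Integration.integrable_bound)
    show "AE x in lborel. norm (f x) \<le> norm (B * indicator (cball 0 r :: 'a set) x :: real)"
    proof (rule AE_I2)
      fix x show "norm (f x) \<le> norm (B * indicator (cball 0 r :: 'a set) x :: real)"
        using assms(3,4)[of x] r by (cases "x \<in> cball 0 r") (auto simp: subset_iff)
    qed
  qed (use assms(1) in simp)
qed

lemma integrable_bump:
  fixes e :: real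
  assumes "0 \<le> e" shows "integrable lborel (bump e :: 'a::euclidean_space \<Rightarrow> real)"
proof (rule integrable_bounded_support[where S = "ball 0 e"])
  show "(bump e :: 'a \<Rightarrow> real) \<in> borel_measurable borel"
    by (rule borel_measurable_continuous_onI[OF continuous_on_bump])
  show "\<And>x::'a. norm (bump e x) \<le> e ^ 4"
    by (simp add: bump_nonneg bump_le)
qed (use assms in \<open>auto intro: bump_eq_0\<close>)

lemma integral_bump_pos:
  fixes e :: real
  assumes "0 < e" shows "0 < (\<integral>z. bump e (z::'a::euclidean_space) \<partial>lborel)"
proof -
  have int: "integrable lborel (bump e :: 'a \<Rightarrow> real)"
    using assms by (intro integrable_bump) simp
  have "(\<integral>z. bump e (z::'a) \<partial>lborel) \<noteq> 0"
  proof
    assume "(\<integral>z. bump e (z::'a) \<partial>lborel) = 0"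
    then have "AE z in lborel. bump e (z::'a) = 0"
      using integral_nonneg_eq_0_iff_AE[OF int] by (simp add: bump_nonneg)
    then have "AE z in lborel. (z::'a) \<notin> ball 0 e"
      by eventually_elim (use bump_pos in fastforce)
    then have "emeasure lborel (ball (0::'a) e) = 0"
      by (subst (asm) AE_iff_measurable[where N = "ball 0 e"]) auto
    then show False using content_ball_gt_0_iff[of "0::'a" e] assms by (simp add: measure_def)
  qed
  moreover have "0 \<le> (\<integral>z. bump e (z::'a) \<partial>lborel)"
    by (intro integral_nonneg_AE) (simp add: bump_nonneg)
  ultimately show ?thesis by simp
qed

text \<open>A single constant \<open>L\<close> bounds the kernel, its gradient \<open>g\<close> and
  the Lipschitz constant of \<open>g\<close>. Its size is irrelevant to the final estimates: the
  sharp constants come from \<open>k_integral\<close> alone, while \<open>L\<close> only secures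
  integrability and differentiability.\<close>

locale mollifier =
  fixes \<epsilon> :: real and k :: "'a::euclidean_space \<Rightarrow> real" and g :: "'a \<Rightarrow> 'a" and L :: real
  assumes eps_pos: "0 < \<epsilon>"
    and L_nonneg: "0 \<le> L"
    and k_nonneg: "0 \<le> k z"
    and k_le: "k z \<le> L"
    and k_eq_0: "\<epsilon> \<le> norm z \<Longrightarrow> k z = 0"
    and k_even: "k (- z) = k z"
    and k_integral: "(\<integral>z. k z \<partial>lborel) = 1"
    and k_has_derivative: "(k has_derivative (\<lambda>h. g z \<bullet> h)) (at z)"
    and g_lipschitz: "norm (g z - g w) \<le> L * norm (z - w)"
    and g_le: "norm (g z) \<le> L"
    and g_eq_0: "\<epsilon> \<le> norm z \<Longrightarrow> g z = 0"
    and g_odd: "g (- z) = - g z"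

lemma mollifier_exists:
  fixes e :: real
  assumes e: "0 < e"
  obtains k and g :: "'a::euclidean_space \<Rightarrow> 'a" and L where "mollifier e k g L"
proof
  define I where "I = (\<integral>z. bump e (z::'a) \<partial>lborel)"
  have I: "0 < I" unfolding I_def by (rule integral_bump_pos[OF e])
  \<comment> \<open>The last parameter adds the bounds from \<open>bump_le\<close>,
    \<open>norm_bump_grad_le\<close> and \<open>bump_grad_lipschitz\<close>, divided by the
    normalizing integral \<open>I\<close>, so it dominates each of them.\<close>
  show "mollifier e (\<lambda>z::'a. bump e z / I) (\<lambda>z. (1 / I) *\<^sub>R bump_grad e z)
      ((e ^ 4 + 4 * e ^ 3 + 12 * e\<^sup>2) / I)"
  proof
    fix z w :: 'a
    have e0: "0 \<le> e" using e by simp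
    show "0 \<le> (e ^ 4 + 4 * e ^ 3 + 12 * e\<^sup>2) / I" using e I by simp
    show "0 \<le> bump e z / I" using I by (simp add: bump_nonneg)
    show "bump e z / I \<le> (e ^ 4 + 4 * e ^ 3 + 12 * e\<^sup>2) / I"
      using I e by (intro divide_right_mono order_trans[OF bump_le]) auto
    show "bump e z / I = 0" if "e \<le> norm z" using bump_eq_0[OF e0 that] by simp
    show "bump e (- z) / I = bump e z / I" by (simp add: bump_def)
    show "(\<integral>z. bump e (z::'a) / I \<partial>lborel) = 1"
      using I by (simp flip: I_def)
    show "((\<lambda>z. bump e z / I) has_derivative (\<lambda>h. (1 / I) *\<^sub>R bump_grad e z \<bullet> h)) (at z)"
      by (rule has_derivative_eq_rhs[OF has_derivative_mult_right[OF bump_has_derivative, of "1 / I", simplified]])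
        (simp add: fun_eq_iff)
    have "norm (bump_grad e z - bump_grad e w) \<le> (e ^ 4 + 4 * e ^ 3 + 12 * e\<^sup>2) * norm (z - w)"
      using e by (intro order_trans[OF bump_grad_lipschitz] mult_right_mono) auto
    then have "norm ((1 / I) *\<^sub>R (bump_grad e z - bump_grad e w)) \<le> (e ^ 4 + 4 * e ^ 3 + 12 * e\<^sup>2) / I * norm (z - w)"
      using I by (simp add: divide_right_mono)
    then show "norm ((1 / I) *\<^sub>R bump_grad e z - (1 / I) *\<^sub>R bump_grad e w) \<le> (e ^ 4 + 4 * e ^ 3 + 12 * e\<^sup>2) / I * norm (z - w)"
      by (simp only: scaleR_diff_right)
    have "norm (bump_grad e z) \<le> e ^ 4 + 4 * e ^ 3 + 12 * e\<^sup>2"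
      using e by (intro order_trans[OF norm_bump_grad_le]) auto
    then show "norm ((1 / I) *\<^sub>R bump_grad e z) \<le> (e ^ 4 + 4 * e ^ 3 + 12 * e\<^sup>2) / I"
      using I by (simp add: divide_right_mono)
    show "(1 / I) *\<^sub>R bump_grad e z = 0" if "e \<le> norm z" using bump_grad_eq_0[OF e0 that] by simp
    show "(1 / I) *\<^sub>R bump_grad e (- z) = - ((1 / I) *\<^sub>R bump_grad e z)" by (simp add: bump_grad_def)
  qed fact
qed

section \<open>Reflection, bounded multipliers, uniqueness of gradients, and Fubini for dominated
  kernels\<close>

lemma lborel_distr_reflect:
  "distr lborel borel (\<lambda>y. x - y) = (lborel :: 'a::euclidean_space measure)"
proof -
  have "(lborel :: 'a measure) = distr lborel borel (\<lambda>y. x + (- 1) *\<^sub>R y)"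
    by (subst lborel_affine[of "- 1" x]) (simp_all add: density_1)
  then show ?thesis by simp
qed

lemma lborel_integral_reflect:
  fixes h :: "'a::euclidean_space \<Rightarrow> 'b::{banach,second_countable_topology}"
  assumes "h \<in> borel_measurable borel"
  shows "(\<integral>y. h (x - y) \<partial>lborel) = (\<integral>y. h y \<partial>lborel)"
proof -
  have "(\<integral>y. h y \<partial>distr lborel borel (\<lambda>y. x - y)) = (\<integral>y. h (x - y) \<partial>lborel)"
    using assms by (intro integral_distr) auto
  then show ?thesis by (simp add: lborel_distr_reflect)
qed

lemma integrable_scaleR_bounded:
  fixes f :: "'a::euclidean_space \<Rightarrow> 'b::{banach,second_countable_topology}"
  assumes c: "c \<in> borel_measurable borel" "\<And>y. \<bar>c y\<bar> \<le> C" and f: "integrable lborel f"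
  shows "integrable lborel (\<lambda>y. c y *\<^sub>R f y)"
proof (rule Bochner_Integration.integrable_bound[of _ "\<lambda>y. C *\<^sub>R f y"])
  show "integrable lborel (\<lambda>y. C *\<^sub>R f y)" using f by simp
  show "(\<lambda>y. c y *\<^sub>R f y) \<in> borel_measurable lborel"
    using c(1) borel_measurable_integrable[OF f] by simp
  show "AE y in lborel. norm (c y *\<^sub>R f y) \<le> norm (C *\<^sub>R f y)"
  proof (rule AE_I2)
    fix y show "norm (c y *\<^sub>R f y) \<le> norm (C *\<^sub>R f y)"
      using c(2)[of y] by (simp add: mult_right_mono)
  qed
qed

lemma norm_integral_scaleR_bounded_le:
  fixes f :: "'a::euclidean_space \<Rightarrow> 'b::{banach,second_countable_topology}"
  assumes "c \<in> borel_measurable borel" "\<And>y. \<bar>c y\<bar> \<le> C" "integrable lborel f"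
  shows "norm (\<integral>y. c y *\<^sub>R f y \<partial>lborel) \<le> C * (\<integral>y. norm (f y) \<partial>lborel)"
proof -
  have "norm (\<integral>y. c y *\<^sub>R f y \<partial>lborel) \<le> (\<integral>y. norm (c y *\<^sub>R f y) \<partial>lborel)"
    by (rule integral_norm_bound)
  also have "\<dots> \<le> (\<integral>y. C * norm (f y) \<partial>lborel)"
    using assms by (intro integral_mono integrable_norm integrable_scaleR_bounded[OF assms])
      (auto intro!: mult_right_mono)
  finally show ?thesis by simp
qed

lemma grad_eq:
  assumes "GDERIV u x :> D" shows "grad u x = D"
proof -
  have uniq: "D' = D" if "GDERIV u x :> D'" for D'
  proof -
    have "(\<lambda>h. h \<bullet> D') = (\<lambda>h. h \<bullet> D)"
      using that assms unfolding gderiv_def by (rule has_derivative_unique)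
    then show ?thesis by (metis vector_eq_ldot)
  qed
  have "(THE D. GDERIV u x :> D) = D"
    using assms by (rule the_equality) (rule uniq)
  moreover have "\<exists>D. GDERIV u x :> D" using assms by (rule exI)
  ultimately show ?thesis by (simp only: grad_def if_True)
qed

text \<open>The product \<open>u x * v y\<close> of two integrable functions is integrable on the
  product space, and \<open>F\<close> inherits this by domination.\<close>

lemma lborel_Fubini_bounded_kernel:
  fixes F :: "'a::euclidean_space \<Rightarrow> 'a \<Rightarrow> real" and u v :: "'a \<Rightarrow> real"
  assumes F: "case_prod F \<in> borel_measurable (borel \<Otimes>\<^sub>M borel)"
    and u: "integrable lborel u" and v: "integrable lborel v"
    and bound: "\<And>x y. \<bar>F x y\<bar> \<le> u x * v y"
  shows "(\<integral>y. (\<integral>x. F x y \<partial>lborel) \<partial>lborel) = (\<integral>x. (\<integral>y. F x y \<partial>lborel) \<partial>lborel)"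
proof (rule lborel_pair.Fubini_integral)
  have [measurable]: "case_prod F \<in> borel_measurable (lborel \<Otimes>\<^sub>M lborel)" using F by simp
  have [measurable]: "u \<in> borel_measurable borel" "v \<in> borel_measurable borel"
    using u v by (auto dest: borel_measurable_integrable)
  have uv: "integrable (lborel \<Otimes>\<^sub>M lborel) (\<lambda>z. u (fst z) * v (snd z))"
  proof (rule lborel_pair.Fubini_integrable)
    show "integrable lborel (\<lambda>x. \<integral>y. norm (u (fst (x, y)) * v (snd (x, y))) \<partial>lborel)"
      using u v by (simp add: abs_mult)
  qed (use v in auto)
  show "integrable (lborel \<Otimes>\<^sub>M lborel) (case_prod F)"
    by (rule Bochner_Integration.integrable_bound[OF uv])
      (use bound in \<open>fastforce intro: AE_I2 order_trans[OF _ abs_ge_self]\<close>)+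
qed

section \<open>Mollification of integrable functions\<close>

context mollifier
begin

lemma continuous_on_k: "continuous_on S k"
  using has_derivative_continuous[OF k_has_derivative] by (simp add: continuous_at_imp_continuous_on)

lemma continuous_on_g: "continuous_on S g"
proof -
  have "L-lipschitz_on S g"
    using g_lipschitz L_nonneg by (auto simp: lipschitz_on_def dist_norm)
  then show ?thesis by (rule lipschitz_on_continuous_on)
qed

lemma measurable_k [measurable]: "k \<in> borel_measurable borel"
  and measurable_g [measurable]: "g \<in> borel_measurable borel"
  by (rule borel_measurable_continuous_onI, rule continuous_on_k continuous_on_g)+

lemma abs_inner_g_le: "\<bar>g z \<bullet> h\<bar> \<le> L * norm h"
  by (meson Cauchy_Schwarz_ineq2 g_le mult_right_mono norm_ge_zero order_trans)

lemma onorm_g_le: "onorm (\<lambda>h. g z \<bullet> h) \<le> L"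
  using abs_inner_g_le by (intro onorm_le) simp

lemma k_lipschitz: "\<bar>k z - k w\<bar> \<le> L * norm (z - w)"
  using differentiable_bound[of UNIV k "\<lambda>z h. g z \<bullet> h" L z w, OF convex_UNIV k_has_derivative onorm_g_le]
  by simp

text \<open>This is the mean value inequality for \<open>k\<close> minus its linearization at
  \<open>z\<close>: along the segment from \<open>z\<close> to \<open>z + h\<close> the gradient
  differs from \<open>g z\<close> by at most \<open>L * norm h\<close>.\<close>

lemma k_taylor: "\<bar>k (z + h) - k z - g z \<bullet> h\<bar> \<le> L * (norm h)\<^sup>2"
proof -
  have "norm (k (z + h) - k z - g z \<bullet> ((z + h) - z)) \<le> norm ((z + h) - z) * (L * norm h)"
  proof (rule differentiable_bound_linearization[where S = "closed_segment z (z + h)" and f' = "\<lambda>z h. g z \<bullet> h"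
        and f = k and a = z and b = "z + h" and ?x0.0 = z])
    show "z + t *\<^sub>R (z + h - z) \<in> closed_segment z (z + h)" if "t \<in> {0..1}" for t
      using that by (auto simp: closed_segment_def algebra_simps intro!: exI[of _ t])
    show "(k has_derivative (\<lambda>h. g x \<bullet> h)) (at x within closed_segment z (z + h))" for x
      using k_has_derivative has_derivative_at_withinI by blast
    show "onorm ((\<lambda>h. g x \<bullet> h) - (\<lambda>h. g z \<bullet> h)) \<le> L * norm h" if "x \<in> closed_segment z (z + h)" for x
      unfolding fun_diff_def
    proof (rule onorm_le)
      fix v :: 'a
      have "norm (x - z) \<le> norm h" using segment_bound1[OF that] by simp
      then have "norm (g x - g z) \<le> L * norm h"
        using g_lipschitz[of x z] L_nonneg by (meson mult_left_mono order_trans)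
      then have "norm (g x - g z) * norm v \<le> L * norm h * norm v"
        by (intro mult_right_mono) auto
      then show "norm (g x \<bullet> v - g z \<bullet> v) \<le> L * norm h * norm v"
        using Cauchy_Schwarz_ineq2[of "g x - g z" v] by (simp add: inner_diff_left)
    qed
  qed simp
  then show ?thesis by (simp add: power2_eq_square ac_simps)
qed

definition conv :: "('a \<Rightarrow> 'b::euclidean_space) \<Rightarrow> 'a \<Rightarrow> 'b" where
  "conv f x = (\<integral>y. k (x - y) *\<^sub>R f y \<partial>lborel)"

lemma integrable_conv:
  fixes f :: "'a \<Rightarrow> 'b::euclidean_space"
  assumes "integrable lborel f" shows "integrable lborel (\<lambda>y. k (x - y) *\<^sub>R f y)"
  using assms k_nonneg k_le by (intro integrable_scaleR_bounded[where C = L]) auto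

lemma integrable_dconv:
  fixes f :: "'a \<Rightarrow> 'b::euclidean_space"
  assumes "integrable lborel f" shows "integrable lborel (\<lambda>y. (g (x - y) \<bullet> h) *\<^sub>R f y)"
  using assms abs_inner_g_le by (intro integrable_scaleR_bounded[where C = "L * norm h"]) auto

lemma bounded_linear_dconv:
  fixes f :: "'a \<Rightarrow> 'b::euclidean_space"
  assumes f: "integrable lborel f"
  shows "bounded_linear (\<lambda>h. \<integral>y. (g (x - y) \<bullet> h) *\<^sub>R f y \<partial>lborel)"
proof (rule bounded_linear_intro)
  fix h h' and r :: real
  show "(\<integral>y. (g (x - y) \<bullet> (h + h')) *\<^sub>R f y \<partial>lborel)
      = (\<integral>y. (g (x - y) \<bullet> h) *\<^sub>R f y \<partial>lborel) + (\<integral>y. (g (x - y) \<bullet> h') *\<^sub>R f y \<partial>lborel)"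
    by (subst Bochner_Integration.integral_add[symmetric])
      (auto intro: integrable_dconv[OF f] simp: inner_add_right scaleR_add_left)
  show "(\<integral>y. (g (x - y) \<bullet> (r *\<^sub>R h)) *\<^sub>R f y \<partial>lborel) = r *\<^sub>R (\<integral>y. (g (x - y) \<bullet> h) *\<^sub>R f y \<partial>lborel)"
    by (simp flip: integral_scaleR_right)
  show "norm (\<integral>y. (g (x - y) \<bullet> h) *\<^sub>R f y \<partial>lborel) \<le> norm h * (L * (\<integral>y. norm (f y) \<partial>lborel))"
    using norm_integral_scaleR_bounded_le[OF _ abs_inner_g_le f, of "\<lambda>y. x - y" h] by (simp add: ac_simps)
qed

text \<open>Integrating \<open>k_taylor\<close> against \<open>f\<close> gives a remainder quadratic
  in \<open>h\<close>, uniformly in the point. This replaces a limit exchange under the integral and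
  lets \<open>f\<close> be any integrable function.\<close>

lemma conv_has_derivative:
  fixes f :: "'a \<Rightarrow> 'b::euclidean_space"
  assumes f: "integrable lborel f"
  shows "(conv f has_derivative (\<lambda>h. \<integral>y. (g (x - y) \<bullet> h) *\<^sub>R f y \<partial>lborel)) (at x)"
proof (rule has_derivative_at_if_quadratic_remainder[OF bounded_linear_dconv[OF f]])
  fix h
  have "conv f (x + h) - conv f x - (\<integral>y. (g (x - y) \<bullet> h) *\<^sub>R f y \<partial>lborel)
      = (\<integral>y. (k ((x - y) + h) - k (x - y) - g (x - y) \<bullet> h) *\<^sub>R f y \<partial>lborel)"
    unfolding conv_def scaleR_diff_left
    using integrable_conv[OF f, of "x + h"] integrable_conv[OF f, of x] integrable_dconv[OF f, of x h]
    by (simp add: algebra_simps)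
  also have "norm \<dots> \<le> L * (norm h)\<^sup>2 * (\<integral>y. norm (f y) \<partial>lborel)"
    by (rule norm_integral_scaleR_bounded_le[OF _ k_taylor f]) measurable
  finally show "norm (conv f (x + h) - conv f x - (\<integral>y. (g (x - y) \<bullet> h) *\<^sub>R f y \<partial>lborel))
      \<le> (L * (\<integral>y. norm (f y) \<partial>lborel)) * (norm h)\<^sup>2"
    by (simp add: ac_simps)
qed

lemma conv_eq_0:
  assumes "\<And>y. norm (x - y) < \<epsilon> \<Longrightarrow> f y = 0" shows "conv f x = 0"
proof -
  have "k (x - y) *\<^sub>R f y = 0" for y
    using assms[of y] k_eq_0[of "x - y"] by fastforce
  then show ?thesis by (simp only: conv_def integral_zero)
qed

lemma dconv_eq_0:
  assumes "\<And>y. norm (x - y) < \<epsilon> \<Longrightarrow> f y = 0" shows "(\<integral>y. f y *\<^sub>R g (x - y) \<partial>lborel) = 0"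
proof -
  have "f y *\<^sub>R g (x - y) = 0" for y
    using assms[of y] g_eq_0[of "x - y"] by fastforce
  then show ?thesis by (simp only: integral_zero)
qed

lemma conv_lipschitz:
  fixes f :: "'a \<Rightarrow> 'b::euclidean_space"
  assumes f: "integrable lborel f"
  shows "(L * (\<integral>y. norm (f y) \<partial>lborel))-lipschitz_on S (conv f)"
proof (rule lipschitz_onI)
  fix x x'
  have "conv f x - conv f x' = (\<integral>y. (k (x - y) - k (x' - y)) *\<^sub>R f y \<partial>lborel)"
    unfolding conv_def scaleR_diff_left using integrable_conv[OF f] by simp
  also have "norm \<dots> \<le> (L * norm (x - x')) * (\<integral>y. norm (f y) \<partial>lborel)"
  proof (rule norm_integral_scaleR_bounded_le[OF _ _ f])
    show "\<bar>k (x - y) - k (x' - y)\<bar> \<le> L * norm (x - x')" for y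
      using k_lipschitz[of "x - y" "x' - y"] by simp
  qed measurable
  finally show "dist (conv f x) (conv f x') \<le> L * (\<integral>y. norm (f y) \<partial>lborel) * dist x x'"
    by (simp add: dist_norm ac_simps)
qed (simp add: L_nonneg)

lemma k_reflect_integrable: "integrable lborel (\<lambda>y. k (x - y))"
  and k_reflect_integral: "(\<integral>y. k (x - y) \<partial>lborel) = 1"
proof -
  show 1: "(\<integral>y. k (x - y) \<partial>lborel) = 1"
    using lborel_integral_reflect[of k x] k_integral by simp
  show "integrable lborel (\<lambda>y. k (x - y))"
    using 1 not_integrable_integral_eq by fastforce
qed

text \<open>Mollifying is averaging, since \<open>k\<close> is a probability density. Hence a field
  of norm at most 1 stays a competitor in the supremum defining the perimeter.\<close>

lemma norm_conv_le:
  fixes f :: "'a \<Rightarrow> 'b::euclidean_space"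
  assumes f: "integrable lborel f" and B: "\<And>y. norm (f y) \<le> B"
  shows "norm (conv f x) \<le> B"
proof -
  have "norm (conv f x) \<le> (\<integral>y. norm (k (x - y) *\<^sub>R f y) \<partial>lborel)"
    unfolding conv_def by (rule integral_norm_bound)
  also have "\<dots> \<le> (\<integral>y. k (x - y) * B \<partial>lborel)"
    using k_reflect_integrable[of x] B
    by (intro integral_mono integrable_norm integrable_conv[OF f]) (auto simp: k_nonneg mult_left_mono)
  finally show ?thesis by (simp add: k_reflect_integral)
qed

text \<open>The derivative, as a bounded linear map, is Lipschitz in the point because
  \<open>g\<close> is, and mollification enlarges the support by at most \<epsilon>. The field
  \<open>f\<close> may be discontinuous, as the normalized gradient used later can be.\<close>

lemma conv_C1_compact_support:
  fixes f :: "'a \<Rightarrow> 'a"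
  assumes f: "integrable lborel f" and S: "bounded S" "\<And>y. y \<notin> S \<Longrightarrow> f y = 0"
  shows "C1_compact_support (conv f)"
proof -
  define D where "D x = Blinfun (\<lambda>h. \<integral>y. (g (x - y) \<bullet> h) *\<^sub>R f y \<partial>lborel)" for x
  have D: "blinfun_apply (D x) = (\<lambda>h. \<integral>y. (g (x - y) \<bullet> h) *\<^sub>R f y \<partial>lborel)" for x
    unfolding D_def by (rule bounded_linear_Blinfun_apply[OF bounded_linear_dconv[OF f]])
  have "(L * (\<integral>y. norm (f y) \<partial>lborel))-lipschitz_on UNIV D"
  proof (rule lipschitz_onI)
    fix x x'
    have "norm (D x - D x') \<le> (L * norm (x - x')) * (\<integral>y. norm (f y) \<partial>lborel)"
    proof (rule norm_blinfun_bound)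
      fix h
      have "blinfun_apply (D x - D x') h = (\<integral>y. ((g (x - y) - g (x' - y)) \<bullet> h) *\<^sub>R f y \<partial>lborel)"
        unfolding minus_blinfun.rep_eq D inner_diff_left scaleR_diff_left using integrable_dconv[OF f] by simp
      also have "norm \<dots> \<le> (L * norm (x - x') * norm h) * (\<integral>y. norm (f y) \<partial>lborel)"
      proof (rule norm_integral_scaleR_bounded_le[OF _ _ f])
        fix y
        have "norm (g (x - y) - g (x' - y)) * norm h \<le> (L * norm (x - x')) * norm h"
          using g_lipschitz[of "x - y" "x' - y"] by (intro mult_right_mono) auto
        then show "\<bar>(g (x - y) - g (x' - y)) \<bullet> h\<bar> \<le> L * norm (x - x') * norm h"
          using Cauchy_Schwarz_ineq2 order_trans by blast
      qed measurable
      finally show "norm (blinfun_apply (D x - D x') h)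
          \<le> L * norm (x - x') * (\<integral>y. norm (f y) \<partial>lborel) * norm h"
        by (simp add: ac_simps)
    qed (simp add: L_nonneg)
    then show "dist (D x) (D x') \<le> L * (\<integral>y. norm (f y) \<partial>lborel) * dist x x'"
      by (simp add: dist_norm ac_simps)
  qed (simp add: L_nonneg)
  then have "continuous_on UNIV D" by (rule lipschitz_on_continuous_on)
  moreover have "(conv f has_derivative blinfun_apply (D x)) (at x)" for x
    unfolding D by (rule conv_has_derivative[OF f])
  moreover have "compact (closure {x. conv f x \<noteq> 0})"
  proof -
    obtain r where r: "S \<subseteq> cball 0 r"
      using bounded_subset_ballD[OF S(1), of 0] ball_subset_cball by blast
    have "{x. conv f x \<noteq> 0} \<subseteq> cball 0 (r + \<epsilon>)"
    proof (rule subsetI, rule ccontr)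
      fix x assume x: "x \<in> {x. conv f x \<noteq> 0}" "x \<notin> cball 0 (r + \<epsilon>)"
      have "f y = 0" if "norm (x - y) < \<epsilon>" for y
      proof (rule S(2))
        show "y \<notin> S" using r x(2) that norm_triangle_sub[of x y] by (force simp: subset_iff)
      qed
      then show False using conv_eq_0[of x f] x by simp
    qed
    then show ?thesis by (meson bounded_cball bounded_closure bounded_subset closed_closure compact_eq_bounded_closed)
  qed
  ultimately show ?thesis unfolding C1_compact_support_def by blast
qed

text \<open>The derivative is an integral of the rank-one maps sending \<open>h\<close> to
  \<open>(g (x - y) \<bullet> h) *\<^sub>R f y\<close>, whose trace is
  \<open>g (x - y) \<bullet> f y\<close>.\<close>

lemma divergence_conv:
  fixes f :: "'a \<Rightarrow> 'a"
  assumes f: "integrable lborel f"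
  shows "divergence (conv f) x = (\<integral>y. g (x - y) \<bullet> f y \<partial>lborel)"
proof -
  have "divergence (conv f) x = (\<Sum>b\<in>Basis. (\<integral>y. (g (x - y) \<bullet> b) *\<^sub>R f y \<partial>lborel) \<bullet> b)"
    unfolding divergence_def by (simp flip: frechet_derivative_at[OF conv_has_derivative[OF f]])
  also have "\<dots> = (\<Sum>b\<in>Basis. (\<integral>y. ((g (x - y) \<bullet> b) *\<^sub>R f y) \<bullet> b \<partial>lborel))"
    using integrable_dconv[OF f] by (intro sum.cong refl integral_inner_left[symmetric]) auto
  also have "\<dots> = (\<integral>y. (\<Sum>b\<in>Basis. ((g (x - y) \<bullet> b) *\<^sub>R f y) \<bullet> b) \<partial>lborel)"
    using integrable_dconv[OF f] by (intro Bochner_Integration.integral_sum[symmetric] integrable_inner_left) auto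
  also have "\<dots> = (\<integral>y. g (x - y) \<bullet> f y \<partial>lborel)"
    by (subst euclidean_inner) simp
  finally show ?thesis .
qed

lemma GDERIV_conv:
  fixes f :: "'a \<Rightarrow> real"
  assumes f: "integrable lborel f"
  shows "GDERIV (conv f) x :> (\<integral>y. f y *\<^sub>R g (x - y) \<partial>lborel)"
proof -
  have "integrable lborel (\<lambda>y. f y *\<^sub>R g (x - y))"
  proof (rule Bochner_Integration.integrable_bound[of _ "\<lambda>y. L * f y"])
    show "AE y in lborel. norm (f y *\<^sub>R g (x - y)) \<le> norm (L * f y)"
      using g_le L_nonneg by (auto simp: abs_mult mult.commute[of L] intro!: AE_I2 mult_left_mono)
  qed (use f in \<open>auto dest: borel_measurable_integrable\<close>)
  then have "(\<lambda>h. \<integral>y. (g (x - y) \<bullet> h) *\<^sub>R f y \<partial>lborel) = (\<lambda>h. h \<bullet> (\<integral>y. f y *\<^sub>R g (x - y) \<partial>lborel))"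
    by (simp add: fun_eq_iff inner_commute mult.commute flip: integral_inner_right)
  then show ?thesis unfolding gderiv_def using conv_has_derivative[OF f, of x] by simp
qed

end

section \<open>Mollified indicator functions\<close>

lemma set_lebesgue_integral_lborel:
  fixes f :: "'a::euclidean_space \<Rightarrow> real"
  assumes "f \<in> borel_measurable borel" "E \<in> sets borel"
  shows "(LINT x:E|lebesgue. f x) = (\<integral>x. indicator E x * f x \<partial>lborel)"
  unfolding set_lebesgue_integral_def using assms by (subst integral_completion) auto

lemma integrable_indicator_bounded:
  fixes S :: "'a::euclidean_space set"
  assumes "S \<in> sets borel" "bounded S"
  shows "integrable lborel (indicator S :: 'a \<Rightarrow> real)"
  using assms by (intro integrable_bounded_support[of _ S 1]) (auto simp: indicator_def)

context mollifier
begin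

lemma grad_conv_measurable:
  assumes [measurable]: "f \<in> borel_measurable borel"
  shows "(\<lambda>x. \<integral>y. f y *\<^sub>R g (x - y) \<partial>lborel) \<in> borel_measurable borel"
  by measurable

lemma conv_measurable:
  fixes f :: "'a \<Rightarrow> 'b::euclidean_space"
  assumes [measurable]: "f \<in> borel_measurable borel"
  shows "conv f \<in> borel_measurable borel"
  unfolding conv_def[abs_def] by measurable

lemma norm_grad_conv_le:
  fixes f :: "'a \<Rightarrow> real"
  assumes f: "integrable lborel f"
  shows "norm (\<integral>y. f y *\<^sub>R g (x - y) \<partial>lborel) \<le> L * (\<integral>y. \<bar>f y\<bar> \<partial>lborel)"
proof -
  have "norm (\<integral>y. f y *\<^sub>R g (x - y) \<partial>lborel) \<le> (\<integral>y. norm (f y *\<^sub>R g (x - y)) \<partial>lborel)"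
    by (rule integral_norm_bound)
  also have "\<dots> \<le> (\<integral>y. L * \<bar>f y\<bar> \<partial>lborel)"
  proof (rule integral_mono_AE')
    show "AE y in lborel. norm (f y *\<^sub>R g (x - y)) \<le> L * \<bar>f y\<bar>"
      using g_le by (auto simp: mult.commute[of L] intro!: AE_I2 mult_left_mono)
  qed (use f L_nonneg in auto)
  finally show ?thesis by simp
qed

lemma notin_if_far:
  assumes "S \<subseteq> cball 0 r" "x \<notin> cball 0 (r + \<epsilon>)" "norm (x - y) < \<epsilon>"
  shows "y \<notin> S"
proof
  assume "y \<in> S"
  then have "norm y \<le> r" using assms(1) by auto
  then show False using assms(2,3) norm_triangle_sub[of x y] by simp
qed

lemma grad_conv_indicator_integrable:
  assumes E: "E \<in> sets borel" "bounded E"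
  shows "integrable lborel (\<lambda>x. \<integral>y. indicator E y *\<^sub>R g (x - y) \<partial>lborel)"
proof -
  have f: "integrable lborel (indicator E :: 'a \<Rightarrow> real)" by (rule integrable_indicator_bounded[OF E])
  obtain r where r: "E \<subseteq> cball 0 r"
    using bounded_subset_ballD[OF E(2), of 0] ball_subset_cball by blast
  show ?thesis
  proof (rule integrable_bounded_support[of _ "cball 0 (r + \<epsilon>)"])
    show "(\<integral>y. indicator E y *\<^sub>R g (x - y) \<partial>lborel) = 0" if "x \<notin> cball 0 (r + \<epsilon>)" for x
      using notin_if_far[OF r that] by (intro dconv_eq_0) simp
    show "norm (\<integral>y. indicator E y *\<^sub>R g (x - y) \<partial>lborel) \<le> L * (\<integral>y. \<bar>indicator E y\<bar> \<partial>lborel)" for x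
      by (rule norm_grad_conv_le[OF f])
  qed (use E grad_conv_measurable in auto)
qed

text \<open>The vector field testing the perimeter is the mollification of the unit field
  \<open>- \<nabla>\<psi> / |\<nabla>\<psi>|\<close> for \<open>\<psi> = conv (indicator E)\<close>. This field is merely bounded and measurable,
  but no integration by parts is needed: as \<open>k\<close> is even, Fubini's theorem moves the mollification
  from the indicator function to the field.\<close>

lemma integral_norm_grad_conv_le_perimeter:
  assumes E: "E \<in> sets borel" "bounded E"
  shows "ereal (\<integral>x. norm (\<integral>y. indicator E y *\<^sub>R g (x - y) \<partial>lborel) \<partial>lborel) \<le> perimeter E"
proof -
  define G where "G x = (\<integral>y. indicator E y *\<^sub>R g (x - y) \<partial>lborel)" for x
  \<comment> \<open>The minus sign is absorbed by the oddness of \<open>g\<close> when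
    \<open>g (y - x)\<close> is turned into \<open>g (x - y)\<close>. As \<open>sgn\<close> is 0 at
    0, the field vanishes wherever \<open>G\<close> does and so has bounded support.\<close>
  define \<phi> where "\<phi> x = - sgn (G x)" for x
  have ind: "integrable lborel (indicator E :: 'a \<Rightarrow> real)" by (rule integrable_indicator_bounded[OF E])
  have indm [measurable]: "(indicator E :: 'a \<Rightarrow> real) \<in> borel_measurable borel" using E by simp
  have Gm [measurable]: "G \<in> borel_measurable borel"
    unfolding G_def[abs_def] by (rule grad_conv_measurable[OF indm])
  have \<phi>m [measurable]: "\<phi> \<in> borel_measurable borel" unfolding \<phi>_def[abs_def] by measurable
  obtain r where r: "E \<subseteq> cball 0 r"
    using bounded_subset_ballD[OF E(2), of 0] ball_subset_cball by blast
  have \<phi>0: "\<phi> x = 0" if "x \<notin> cball 0 (r + \<epsilon>)" for x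
    unfolding \<phi>_def G_def using notin_if_far[OF r that] by (subst dconv_eq_0) auto
  have \<phi>1: "norm (\<phi> x) \<le> 1" for x by (simp add: \<phi>_def norm_sgn)
  have \<phi>i: "integrable lborel \<phi>"
    by (rule integrable_bounded_support[OF \<phi>m bounded_cball \<phi>0 \<phi>1])
  have div: "divergence (conv \<phi>) y = (\<integral>x. g (x - y) \<bullet> sgn (G x) \<partial>lborel)" for y
    unfolding divergence_conv[OF \<phi>i]
  proof (intro Bochner_Integration.integral_cong refl)
    fix x show "g (y - x) \<bullet> \<phi> x = g (x - y) \<bullet> sgn (G x)"
      using g_odd[of "x - y"] by (simp add: \<phi>_def)
  qed
  have divm: "divergence (conv \<phi>) \<in> borel_measurable borel"
    unfolding div[abs_def] by measurable
  have "(LINT y:E|lebesgue. divergence (conv \<phi>) y)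
      = (\<integral>y. (\<integral>x. indicator E y * (g (x - y) \<bullet> sgn (G x)) \<partial>lborel) \<partial>lborel)"
    by (subst set_lebesgue_integral_lborel[OF divm E(1)]) (simp add: div)
  also have "\<dots> = (\<integral>x. (\<integral>y. indicator E y * (g (x - y) \<bullet> sgn (G x)) \<partial>lborel) \<partial>lborel)"
  proof (rule lborel_Fubini_bounded_kernel)
    show "integrable lborel (\<lambda>x. L * norm (\<phi> x))" using \<phi>i by simp
    show "\<bar>indicator E y * (g (x - y) \<bullet> sgn (G x))\<bar> \<le> L * norm (\<phi> x) * indicator E y" for x y
      using abs_inner_g_le[of "x - y" "sgn (G x)"] by (simp add: \<phi>_def indicator_def)
  qed (use ind in measurable)
  also have "\<dots> = (\<integral>x. norm (G x) \<partial>lborel)"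
  proof (intro Bochner_Integration.integral_cong refl)
    fix x
    have "integrable lborel (\<lambda>y. indicator E y *\<^sub>R g (x - y))"
    proof (rule integrable_bounded_support[OF _ E(2)])
      show "norm (indicator E y *\<^sub>R g (x - y)) \<le> L" for y
        using g_le[of "x - y"] L_nonneg by (simp add: indicator_def)
    qed auto
    then have "(\<integral>y. indicator E y * (g (x - y) \<bullet> sgn (G x)) \<partial>lborel) = G x \<bullet> sgn (G x)"
      unfolding G_def by (simp flip: integral_inner_left)
    also have "\<dots> = norm (G x)"
      by (cases "G x = 0") (simp_all add: sgn_div_norm power2_norm_eq_inner[symmetric] power2_eq_square)
    finally show "(\<integral>y. indicator E y * (g (x - y) \<bullet> sgn (G x)) \<partial>lborel) = norm (G x)" .
  qed
  finally have eq: "(\<integral>x. norm (G x) \<partial>lborel) = (LINT y:E|lebesgue. divergence (conv \<phi>) y)" by simp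
  have "conv \<phi> \<in> {\<phi>. C1_compact_support \<phi> \<and> (\<forall>x. norm (\<phi> x) \<le> 1)}"
    using conv_C1_compact_support[OF \<phi>i bounded_cball \<phi>0] norm_conv_le[OF \<phi>i \<phi>1] by blast
  then show ?thesis
    unfolding perimeter_def G_def[symmetric] eq by (rule SUP_upper)
qed

text \<open>After Fubini the inner integral is that of the translated kernel, reflected by evenness,
  hence 1. The exchange is dominated by a product because the integrand vanishes for
  \<open>x\<close> outside an enlarged ball.\<close>

lemma integral_conv:
  fixes f :: "'a \<Rightarrow> real"
  assumes f: "integrable lborel f" and S: "bounded S" "\<And>y. y \<notin> S \<Longrightarrow> f y = 0"
  shows "integrable lborel (conv f)" and "(\<integral>x. conv f x \<partial>lborel) = (\<integral>y. f y \<partial>lborel)"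
proof -
  obtain r where r: "S \<subseteq> cball 0 r"
    using bounded_subset_ballD[OF S(1), of 0] ball_subset_cball by blast
  have fm [measurable]: "f \<in> borel_measurable borel" using f by (auto dest: borel_measurable_integrable)
  have k0: "k (x - y) * f y = 0" if "x \<notin> cball 0 (r + \<epsilon>)" for x y
    using notin_if_far[OF r that, of y] S(2)[of y] k_eq_0[of "x - y"] by fastforce
  show "integrable lborel (conv f)"
  proof (rule integrable_bounded_support[of _ "cball 0 (r + \<epsilon>)"])
    show "conv f x = 0" if "x \<notin> cball 0 (r + \<epsilon>)" for x
      using k0[OF that] by (simp only: conv_def real_scaleR_def integral_zero)
    show "norm (conv f x) \<le> L * (\<integral>y. norm (f y) \<partial>lborel)" for x
      unfolding conv_def using k_nonneg k_le by (intro norm_integral_scaleR_bounded_le[OF _ _ f]) auto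
  qed (use conv_measurable[OF fm] in auto)
  have "(\<integral>x. conv f x \<partial>lborel) = (\<integral>x. (\<integral>y. k (x - y) * f y \<partial>lborel) \<partial>lborel)"
    by (simp add: conv_def)
  also have "\<dots> = (\<integral>y. (\<integral>x. k (x - y) * f y \<partial>lborel) \<partial>lborel)"
  proof (rule lborel_Fubini_bounded_kernel[symmetric])
    show "integrable lborel (\<lambda>x. L * indicator (cball (0::'a) (r + \<epsilon>)) x)"
      by (intro integrable_mult_right integrable_indicator_bounded) auto
    show "integrable lborel (\<lambda>y. \<bar>f y\<bar>)" using f by simp
    show "\<bar>k (x - y) * f y\<bar> \<le> L * indicator (cball 0 (r + \<epsilon>)) x * \<bar>f y\<bar>" for x y
      using k0[of x y] k_le[of "x - y"] k_nonneg[of "x - y"]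
      by (cases "x \<in> cball 0 (r + \<epsilon>)") (auto simp: abs_mult mult_right_mono)
  qed measurable
  also have "\<dots> = (\<integral>y. f y \<partial>lborel)"
  proof (intro Bochner_Integration.integral_cong refl)
    fix y
    have "k (x - y) = k (y - x)" for x using k_even[of "x - y"] by simp
    then show "(\<integral>x. k (x - y) * f y \<partial>lborel) = f y"
      using k_reflect_integral[of y] k_reflect_integrable[of y] by simp
  qed
  finally show "(\<integral>x. conv f x \<partial>lborel) = (\<integral>y. f y \<partial>lborel)" .
qed

text \<open>Pointwise \<open>conv (indicator E) \<le> indicator E + indicator (U - E) + conv (indicator (E - K))\<close>,
  and since \<open>conv\<close> preserves integrals, the positive part of the error controls its \<open>L\<^sup>1\<close> norm.\<close>

lemma conv_indicator_L1_error:
  assumes meas: "K \<in> sets borel" "E \<in> sets borel" "U \<in> sets borel"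
    and sub: "K \<subseteq> E" "E \<subseteq> U" and bdd: "bounded E"
    and fin: "emeasure lborel (U - E) < \<infinity>"
    and near: "\<And>x. x \<in> K \<Longrightarrow> ball x \<epsilon> \<subseteq> U"
  shows "(\<integral>x. \<bar>conv (indicator E) x - (indicator E x :: real)\<bar> \<partial>lborel)
    \<le> 2 * (measure lborel (U - E) + measure lborel (E - K))"
proof -
  have iE: "integrable lborel (indicator E :: 'a \<Rightarrow> real)"
    using meas bdd by (intro integrable_indicator_bounded)
  have bEK: "bounded (E - K)" using bdd by (rule bounded_subset) auto
  have iK: "integrable lborel (indicator K :: 'a \<Rightarrow> real)"
    using meas bounded_subset[OF bdd sub(1)] by (intro integrable_indicator_bounded)
  have iEK: "integrable lborel (indicator (E - K) :: 'a \<Rightarrow> real)"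
    using meas bEK by (intro integrable_indicator_bounded) auto
  have iU: "integrable lborel (indicator (U - E) :: 'a \<Rightarrow> real)"
    using meas fin by (simp add: integrable_indicator_iff)
  note cE = integral_conv[OF iE bdd indicator_simps(2)]
    and cEK = integral_conv[OF iEK bEK indicator_simps(2)]
  have conv_nonneg: "0 \<le> conv (indicator A :: 'a \<Rightarrow> real) x" for A x
    unfolding conv_def by (intro integral_nonneg_AE AE_I2) (simp add: k_nonneg)
  have le1: "conv (indicator E) x \<le> (1::real)" for x
    using norm_conv_le[OF iE, of 1 x] by (auto simp: indicator_def)
  \<comment> \<open>The right-hand side comes from |t| = 2 max(0, t) - t with \<open>t\<close> the
    pointwise error, so that only an upper bound for the positive part is required.\<close>
  have pw: "\<bar>conv (indicator E) x - (indicator E x :: real)\<bar>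
      \<le> 2 * (indicator (U - E) x + conv (indicator (E - K)) x) - conv (indicator E) x + indicator E x"
    (is "\<bar>?c - _\<bar> \<le> _") for x
  proof -
    \<comment> \<open>In \<open>U\<close> the two indicators add up to 1, which bounds the mollified
      function. Outside \<open>U\<close> every point of \<open>K\<close> is at distance at least
      \<epsilon>, so only the part of \<open>E\<close> outside \<open>K\<close> contributes.\<close>
    have "?c \<le> indicator E x + indicator (U - E) x + conv (indicator (E - K)) x"
    proof (cases "x \<in> U")
      case True
      then show ?thesis using le1[of x] conv_nonneg[of "E - K" x] by (simp add: indicator_def)
    next
      case False
      have "conv (indicator E) x = conv (indicator K) x + (conv (indicator (E - K)) x :: real)"
      proof -
        have "(\<lambda>y. k (x - y) *\<^sub>R indicator E y) = (\<lambda>y. k (x - y) *\<^sub>R indicator K y + k (x - y) *\<^sub>R (indicator (E - K) y :: real))"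
          using sub by (auto simp: fun_eq_iff indicator_def)
        then show ?thesis
          unfolding conv_def using integrable_conv[OF iK, of x] integrable_conv[OF iEK, of x] by simp
      qed
      moreover have "conv (indicator K) x = (0::real)"
      proof (rule conv_eq_0)
        fix y assume "norm (x - y) < \<epsilon>"
        then have "x \<in> ball y \<epsilon>" by (simp add: dist_norm norm_minus_commute)
        then have "y \<notin> K" using near False by blast
        then show "indicator K y = (0::real)" by simp
      qed
      ultimately show ?thesis using False sub by (auto simp: indicator_def)
    qed
    moreover have "(0::real) \<le> indicator (U - E) x" by simp
    ultimately show ?thesis
      using conv_nonneg[of "E - K" x] unfolding abs_le_iff distrib_left by linarith
  qed
  have "(\<integral>x. \<bar>conv (indicator E) x - (indicator E x :: real)\<bar> \<partial>lborel)
      \<le> (\<integral>x. 2 * (indicator (U - E) x + conv (indicator (E - K)) x) - conv (indicator E) x + indicator E x \<partial>lborel)"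
    using iE iU cE(1) cEK(1) by (intro integral_mono pw) auto
  \<comment> \<open>The integrals of \<open>conv (indicator E)\<close> and
    \<open>indicator E\<close> cancel, and that of \<open>conv (indicator (E - K))\<close> is the
    measure of \<open>E - K\<close>.\<close>
  also have "\<dots> = 2 * (measure lborel (U - E) + measure lborel (E - K))"
    using iE iU iEK cE cEK meas by simp
  finally show ?thesis .
qed

end

text \<open>Regularity of Lebesgue measure places \<open>E\<close> between a closed \<open>K\<close>
  and an open \<open>U\<close> with gaps of measure below \<delta>/4, so the previous error bound
  gives \<delta>. The mollification radius is small enough that balls around points of
  \<open>K\<close> stay in \<open>U\<close> and balls around points of \<open>closure E\<close> stay
  in \<Omega>.\<close>

lemma mollified_indicator:
  fixes E :: "'a::euclidean_space set" and \<delta> :: real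
  assumes E: "E \<in> sets borel" "bounded E" and \<Omega>: "open \<Omega>" "closure E \<subseteq> \<Omega>" and "0 < \<delta>"
  obtains \<psi> G L where "L-lipschitz_on UNIV \<psi>" "\<And>x. GDERIV \<psi> x :> G x"
    "integrable lborel G" "ereal (\<integral>x. norm (G x) \<partial>lborel) \<le> perimeter E"
    "\<And>x. x \<notin> \<Omega> \<Longrightarrow> \<psi> x = 0" "\<And>x. \<bar>\<psi> x\<bar> \<le> 1" "\<psi> \<in> borel_measurable borel"
    "integrable lborel (\<lambda>x. \<psi> x - indicator E x)"
    "(\<integral>x. \<bar>\<psi> x - indicator E x\<bar> \<partial>lborel) \<le> \<delta>"
proof -
  have El: "E \<in> sets lebesgue" using E by simp
  have d4: "0 < \<delta> / 4" using \<open>0 < \<delta>\<close> by simp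
  obtain K where K: "closed K" "K \<subseteq> E" "E - K \<in> lmeasurable" "emeasure lebesgue (E - K) < ennreal (\<delta> / 4)"
    using sets_lebesgue_inner_closed[OF El d4] by blast
  obtain U where U: "open U" "E \<subseteq> U" "U - E \<in> lmeasurable" "emeasure lebesgue (U - E) < ennreal (\<delta> / 4)"
    using sets_lebesgue_outer_open[OF El d4] by blast
  have "compact K" using K E(2) by (meson bounded_subset compact_eq_bounded_closed)
  then obtain e1 where e1: "0 < e1" "(\<Union>x\<in>K. ball x e1) \<subseteq> U"
    using compact_subset_open_imp_ball_epsilon_subset U K by (metis order_trans)
  have "compact (closure E)" using E(2) by simp
  then obtain e2 where e2: "0 < e2" "(\<Union>x\<in>closure E. ball x e2) \<subseteq> \<Omega>"
    using compact_subset_open_imp_ball_epsilon_subset \<Omega> by metis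
  define e where "e = min e1 e2"
  have e: "0 < e" using e1 e2 by (simp add: e_def)
  obtain k and g :: "'a \<Rightarrow> 'a" and L where "mollifier e k g L" using mollifier_exists[OF e] .
  then interpret mollifier e k g L .
  have iE: "integrable lborel (indicator E :: 'a \<Rightarrow> real)" by (rule integrable_indicator_bounded[OF E])
  show thesis
  proof (rule that[of _ "conv (indicator E)"])
    show "conv (indicator E) x = (0::real)" if "x \<notin> \<Omega>" for x
    proof (rule conv_eq_0)
      fix y assume "norm (x - y) < e"
      then have "x \<in> ball y e2" by (simp add: dist_norm norm_minus_commute e_def)
      then have "y \<notin> closure E" using e2(2) that by blast
      then show "indicator E y = (0::real)" using closure_subset by (auto simp: indicator_def)
    qed
    show "\<bar>conv (indicator E) x\<bar> \<le> (1::real)" for x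
      using norm_conv_le[OF iE, of 1 x] by (auto simp: indicator_def)
    show "integrable lborel (\<lambda>x. conv (indicator E) x - (indicator E x :: real))"
      using integral_conv(1)[OF iE E(2) indicator_simps(2)] iE by simp
    have "emeasure lborel (U - E) < \<infinity>"
      using U E by (simp add: less_top[symmetric] fmeasurable_def)
    moreover have "ball x e \<subseteq> U" if "x \<in> K" for x
      using e1(2) that unfolding e_def by fastforce
    ultimately have "(\<integral>x. \<bar>conv (indicator E) x - (indicator E x :: real)\<bar> \<partial>lborel)
        \<le> 2 * (measure lborel (U - E) + measure lborel (E - K))"
      using K U E by (intro conv_indicator_L1_error) auto
    also have "\<dots> \<le> 2 * (\<delta> / 4 + \<delta> / 4)"
    proof -
      have "measure lebesgue (U - E) \<le> \<delta> / 4" "measure lebesgue (E - K) \<le> \<delta> / 4"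
        using K U d4 by (auto simp: emeasure_eq_measure2 ennreal_less_iff)
      then show ?thesis using K U E by simp
    qed
    finally show "(\<integral>x. \<bar>conv (indicator E) x - (indicator E x :: real)\<bar> \<partial>lborel) \<le> \<delta>" by simp
  qed (use conv_lipschitz[OF iE] GDERIV_conv[OF iE] grad_conv_indicator_integrable[OF E]
      integral_norm_grad_conv_le_perimeter[OF E] conv_measurable[of "indicator E :: 'a \<Rightarrow> real"] E in auto)
qed

section \<open>Testing Gauss' law\<close>

text \<open>A short step from \<open>x\<close> in the direction of the gradient \<open>D\<close>
  changes \<psi> by nearly \<open>norm D\<close> times its length, and the Lipschitz bound limits
  this change. At points without a derivative the default value 0 of \<open>grad\<close> obeys the
  bound, since a Lipschitz constant is nonnegative.\<close>

lemma norm_grad_le_lipschitz: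
  fixes \<psi> :: "'a::euclidean_space \<Rightarrow> real"
  assumes S: "open S" "x \<in> S" and lip: "C-lipschitz_on S \<psi>"
  shows "norm (grad \<psi> x) \<le> C"
proof (cases "\<exists>D. GDERIV \<psi> x :> D")
  case False
  then show ?thesis using lip by (simp add: grad_def lipschitz_on_def)
next
  case True
  then obtain D where D: "GDERIV \<psi> x :> D" by blast
  have "norm D \<le> C"
  proof (cases "D = 0")
    case True
    then show ?thesis using lip by (simp add: lipschitz_on_def)
  next
    case D0: False
    show ?thesis
    proof (rule field_le_epsilon)
      fix e :: real assume "0 < e"
      then obtain d where d: "0 < d" "\<And>y. norm (y - x) < d \<Longrightarrow> \<bar>\<psi> y - \<psi> x - (y - x) \<bullet> D\<bar> \<le> e * norm (y - x)"
        using D unfolding gderiv_def has_derivative_at_alt real_norm_def by blast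
      obtain r where r: "0 < r" "ball x r \<subseteq> S" using S by (meson openE)
      \<comment> \<open>The step then has length \<open>min d r / 2\<close>, inside both the
        differentiability radius and the ball contained in \<open>S\<close>.\<close>
      define t where "t = min d r / (2 * norm D)"
      have t: "0 < t" "t * norm D < d" "t * norm D < r"
        using d r D0 by (auto simp: t_def min_def)
      define y where "y = x + t *\<^sub>R D"
      have ny: "norm (y - x) = t * norm D" using t by (simp add: y_def)
      then have "y \<in> S" using r t by (auto simp: dist_norm norm_minus_commute intro!: subsetD[OF r(2)])
      then have "\<bar>\<psi> y - \<psi> x\<bar> \<le> C * norm (y - x)"
        using lipschitz_onD[OF lip _ S(2)] by (simp add: dist_norm)
      moreover have "\<bar>\<psi> y - \<psi> x - (y - x) \<bullet> D\<bar> \<le> e * norm (y - x)"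
        using t ny by (intro d(2)) simp
      ultimately have "(y - x) \<bullet> D \<le> (C + e) * norm (y - x)"
        unfolding distrib_right by linarith
      moreover have "(y - x) \<bullet> D = t * norm D * norm D"
        by (simp add: y_def power2_norm_eq_inner[symmetric] power2_eq_square)
      ultimately have "norm D * (t * norm D) \<le> (C + e) * (t * norm D)"
        using ny by (simp add: ac_simps)
      then show "norm D \<le> C + e" using t D0 by (simp add: mult_le_cancel_right)
    qed
  qed
  then show ?thesis using grad_eq[OF D] by simp
qed

lemma grad_locally_const:
  fixes \<psi> :: "'a::euclidean_space \<Rightarrow> real"
  assumes "open S" "x \<in> S" "\<And>y. y \<in> S \<Longrightarrow> \<psi> y = c"
  shows "grad \<psi> x = 0"
  using norm_grad_le_lipschitz[of S x 0 \<psi>] assms by (simp add: lipschitz_on_def)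

text \<open>A series of nonnegative terms always converges in \<open>ereal\<close>; as its value is
  real here, the real series converges to the same number.\<close>

lemma max_displacement_sums:
  assumes "admissible_coeffs a" "0 < \<sigma>" "max_displacement a \<sigma> = ereal \<Lambda>"
  shows "(\<lambda>p. a (p + 2) * \<sigma> ^ (p + 1)) sums \<Lambda>"
proof -
  have "0 \<le> a (p + 2) * \<sigma> ^ (p + 1)" for p
    using assms by (simp add: admissible_coeffs_def)
  then have "summable (\<lambda>p. ereal (a (p + 2) * \<sigma> ^ (p + 1)))"
    by (intro summable_ereal_pos) auto
  then have "(\<lambda>p. ereal (a (p + 2) * \<sigma> ^ (p + 1))) sums ereal \<Lambda>"
    using assms(3) unfolding max_displacement_def by (metis summable_sums)
  then show ?thesis by (simp only: sums_ereal)
qed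

lemma max_displacement_nonneg:
  assumes "admissible_coeffs a" "0 < \<sigma>" "max_displacement a \<sigma> = ereal \<Lambda>"
  shows "0 \<le> \<Lambda>"
proof -
  have "0 \<le> a (p + 2) * \<sigma> ^ (p + 1)" for p
    using assms by (simp add: admissible_coeffs_def)
  then show ?thesis using sums_le[OF _ sums_zero max_displacement_sums[OF assms]] by blast
qed

text \<open>The integrable majorant \<open>b\<close> stands for the norm of the gradient of \<psi>.
  It is that norm itself for mollified indicators, and a multiple of the indicator of an annulus for
  radial cutoffs, which have corners.\<close>

lemma charge_le_displacement_times_variation:
  fixes \<Omega> :: "'a::euclidean_space set"
  assumes law: "admissible_coeffs a" "0 < \<sigma>" "max_displacement a \<sigma> = ereal \<Lambda>"
    and u: "electrostatic_potential a \<sigma> \<Omega> \<rho> g u"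
    and \<psi>: "test_function \<Omega> \<psi>"
    and b: "set_integrable lebesgue \<Omega> b" "\<And>x. x \<in> \<Omega> \<Longrightarrow> norm (grad \<psi> x) \<le> b x"
  shows "\<bar>LINT x:\<Omega>|lebesgue. \<rho> x * \<psi> x\<bar> \<le> \<Lambda> * (LINT x:\<Omega>|lebesgue. b x)"
proof -
  define B where "B = (LINT x:\<Omega>|lebesgue. b x)"
  define I where "I p = (LINT x:\<Omega>|lebesgue. norm (grad u x) ^ p * (grad u x \<bullet> grad \<psi> x))" for p
  define S where "S = (LINT x:\<Omega>|lebesgue. \<rho> x * \<psi> x)"
  have ae: "AE x in lebesgue. x \<in> \<Omega> \<longrightarrow> norm (grad u x) \<le> \<sigma>"
    and S: "(\<lambda>p. a (p + 2) * I p) sums S"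
    using u \<psi> unfolding electrostatic_potential_def I_def S_def by blast+
  \<comment> \<open>The field contributes \<open>p\<close> powers of \<sigma> through its norm and
    one more by Cauchy-Schwarz. With coefficient \<open>a (p + 2)\<close> these are exactly the
    terms of \<Lambda>.\<close>
  have I: "\<bar>I p\<bar> \<le> \<sigma> ^ (p + 1) * B" for p
  proof -
    let ?f = "\<lambda>x. indicator \<Omega> x *\<^sub>R (norm (grad u x) ^ p * (grad u x \<bullet> grad \<psi> x))"
    \<comment> \<open>This and the next comparison hold also for the default value 0 of a
      nonintegrable integrand; integrability is asked of the majorant only.\<close>
    have "\<bar>I p\<bar> \<le> (\<integral>x. norm (?f x) \<partial>lebesgue)"
      unfolding I_def set_lebesgue_integral_def using integral_norm_bound[of lebesgue ?f] by simp
    also have "\<dots> \<le> (\<integral>x. \<sigma> ^ (p + 1) * (indicator \<Omega> x *\<^sub>R b x) \<partial>lebesgue)"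
    proof (rule integral_mono_AE')
      show "integrable lebesgue (\<lambda>x. \<sigma> ^ (p + 1) * (indicator \<Omega> x *\<^sub>R b x))"
        using b(1) unfolding set_integrable_def by simp
      show "AE x in lebesgue. norm (?f x) \<le> \<sigma> ^ (p + 1) * (indicator \<Omega> x *\<^sub>R b x)"
        using ae
      proof eventually_elim
        fix x assume x: "x \<in> \<Omega> \<longrightarrow> norm (grad u x) \<le> \<sigma>"
        show "norm (?f x) \<le> \<sigma> ^ (p + 1) * (indicator \<Omega> x *\<^sub>R b x)"
        proof (cases "x \<in> \<Omega>")
          case True
          have "\<bar>grad u x \<bullet> grad \<psi> x\<bar> \<le> \<sigma> * b x"
            using x True b(2)[OF True] law(2) by (intro order_trans[OF Cauchy_Schwarz_ineq2] mult_mono) auto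
          moreover have "norm (grad u x) ^ p \<le> \<sigma> ^ p"
            using x True by (intro power_mono) auto
          ultimately have "norm (grad u x) ^ p * \<bar>grad u x \<bullet> grad \<psi> x\<bar> \<le> \<sigma> ^ p * (\<sigma> * b x)"
            using law(2) by (intro mult_mono) auto
          then show ?thesis using True by (simp add: abs_mult ac_simps)
        qed simp
      qed
      show "AE x in lebesgue. 0 \<le> \<sigma> ^ (p + 1) * (indicator \<Omega> x *\<^sub>R b x)"
        using law(2) order_trans[OF norm_ge_zero b(2)] by (intro AE_I2) (simp add: indicator_def)
    qed
    also have "\<dots> = \<sigma> ^ (p + 1) * B" by (simp add: B_def set_lebesgue_integral_def)
    finally show ?thesis .
  qed
  have le: "\<bar>a (p + 2) * I p\<bar> \<le> a (p + 2) * \<sigma> ^ (p + 1) * B" for p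
  proof -
    have "0 \<le> a (p + 2)" using law(1) by (simp add: admissible_coeffs_def)
    then have "a (p + 2) * \<bar>I p\<bar> \<le> a (p + 2) * (\<sigma> ^ (p + 1) * B)"
      by (intro mult_left_mono I)
    then show ?thesis using \<open>0 \<le> a (p + 2)\<close> by (simp add: abs_mult ac_simps)
  qed
  have maj: "(\<lambda>p. a (p + 2) * \<sigma> ^ (p + 1) * B) sums (\<Lambda> * B)"
    by (rule sums_mult2[OF max_displacement_sums[OF law]])
  have "S \<le> \<Lambda> * B"
    using le by (intro sums_le[OF _ S maj]) (simp add: abs_le_iff)
  moreover have "- S \<le> \<Lambda> * B"
    using le by (intro sums_le[OF _ sums_minus[OF S] maj]) (simp add: abs_le_iff)
  ultimately show ?thesis unfolding S_def B_def by (simp add: abs_le_iff)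
qed

section \<open>From Borel sets to Lebesgue sets of finite perimeter\<close>

lemma divergence_measurable:
  assumes "C1_compact_support \<phi>" shows "divergence \<phi> \<in> borel_measurable borel"
proof -
  obtain D where D: "\<And>x. (\<phi> has_derivative blinfun_apply (D x)) (at x)" "continuous_on UNIV D"
    using assms unfolding C1_compact_support_def by blast
  have "divergence \<phi> = (\<lambda>x. \<Sum>b\<in>Basis. blinfun_apply (D x) b \<bullet> b)"
    unfolding divergence_def[abs_def] by (simp add: frechet_derivative_at[OF D(1), symmetric])
  moreover have "continuous_on UNIV (\<lambda>x. \<Sum>b\<in>Basis. blinfun_apply (D x) b \<bullet> b)"
    by (intro continuous_intros D(2))
  ultimately show ?thesis by (simp add: borel_measurable_continuous_onI)
qed

lemma borel_measurable_imp_lebesgue: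
  "f \<in> borel_measurable borel \<Longrightarrow> f \<in> borel_measurable lebesgue"
  by (rule measurable_completion) simp

text \<open>The perimeter sees a set only through integrals over it, so a Lebesgue set may be
  replaced by a Borel representative.\<close>

lemma perimeter_cong_AE:
  assumes "E \<in> sets lebesgue" "F \<in> sets lebesgue" "AE x in lebesgue. x \<in> E \<longleftrightarrow> x \<in> F"
  shows "perimeter E = perimeter F"
  unfolding perimeter_def
proof (intro SUP_cong refl arg_cong[where f = ereal])
  fix \<phi> :: "'a \<Rightarrow> 'a" assume "\<phi> \<in> {\<phi>. C1_compact_support \<phi> \<and> (\<forall>x. norm (\<phi> x) \<le> 1)}"
  then have [measurable]: "divergence \<phi> \<in> borel_measurable lebesgue"
    by (intro borel_measurable_imp_lebesgue divergence_measurable) simp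
  show "(LINT x:E|lebesgue. divergence \<phi> x) = (LINT x:F|lebesgue. divergence \<phi> x)"
    unfolding set_lebesgue_integral_def
  proof (rule integral_cong_AE)
    show "AE x in lebesgue. indicator E x *\<^sub>R divergence \<phi> x = indicator F x *\<^sub>R divergence \<phi> x"
      using assms(3) by eventually_elim (auto simp: indicator_def)
  qed (use assms(1,2) in measurable)
qed

text \<open>A representative inside \<open>E\<close> inherits boundedness and compact containment in
  \<Omega>, which a Borel superset could lose.\<close>

lemma lebesgue_set_inner_borel:
  fixes E :: "'a::euclidean_space set"
  assumes "E \<in> sets lebesgue"
  obtains C where "C \<in> sets borel" "C \<subseteq> E" "AE x in lebesgue. x \<in> C \<longleftrightarrow> x \<in> E"
proof -
  obtain C N N' where C: "E = C \<union> N" "N \<subseteq> N'" "N' \<in> null_sets lborel" "C \<in> sets lborel"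
    using assms by (rule sets_completionE)
  have "AE x in lborel. x \<notin> N'" using AE_not_in C(3) by blast
  then have "AE x in lebesgue. x \<notin> N'" by (rule AE_completion)
  then have "AE x in lebesgue. x \<in> C \<longleftrightarrow> x \<in> E"
    by eventually_elim (use C in auto)
  then show thesis using that[of C] C by auto
qed

text \<open>As \<rho> is merely integrable, convergence of the test functions in L^1 does not by
  itself carry over to the charges. An almost everywhere convergent subsequence together with the
  bound 1 on the test functions gives dominated convergence with majorant |\<rho>|.\<close>

lemma charge_le_displacement_times_perimeter:
  fixes \<Omega> E :: "'a::euclidean_space set"
  assumes law: "admissible_coeffs a" "0 < \<sigma>" "max_displacement a \<sigma> = ereal \<Lambda>"
    and \<Omega>: "open \<Omega>" and \<rho>: "set_integrable lebesgue \<Omega> \<rho>"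
    and u: "electrostatic_potential a \<sigma> \<Omega> \<rho> g u"
    and E: "E \<in> sets lebesgue" "compactly_contained E \<Omega>"
  shows "ereal \<bar>LINT x:E|lebesgue. \<rho> x\<bar> \<le> ereal \<Lambda> * perimeter E"
proof -
  obtain C where C: "C \<in> sets borel" "C \<subseteq> E" "AE x in lebesgue. x \<in> C \<longleftrightarrow> x \<in> E"
    using lebesgue_set_inner_borel[OF E(1)] .
  have per: "perimeter C = perimeter E"
    using C E(1) by (intro perimeter_cong_AE) auto
  have clE: "closure E \<subseteq> \<Omega>" and "bounded E"
    using E(2) bounded_subset[OF compact_imp_bounded closure_subset]
    unfolding compactly_contained_def by blast+
  then have bC: "bounded C" and clC: "closure C \<subseteq> \<Omega>"
    using C(2) bounded_subset closure_mono by blast+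
  have "E \<subseteq> \<Omega>" using clE closure_subset by blast
  \<comment> \<open>This predicate bundles the conclusions of \<open>mollified_indicator\<close>
    with error 1/(n + 1), so that one application of choice yields the whole sequence.\<close>
  define approx where "approx n \<psi> \<longleftrightarrow> (\<exists>L. L-lipschitz_on UNIV \<psi>)
      \<and> (\<exists>G. (\<forall>x. GDERIV \<psi> x :> G x) \<and> integrable lborel G \<and> ereal (\<integral>x. norm (G x) \<partial>lborel) \<le> perimeter C)
      \<and> (\<forall>x. x \<notin> \<Omega> \<longrightarrow> \<psi> x = 0) \<and> (\<forall>x. \<bar>\<psi> x\<bar> \<le> 1) \<and> \<psi> \<in> borel_measurable borel
      \<and> integrable lborel (\<lambda>x. \<psi> x - indicator C x)
      \<and> (\<integral>x. \<bar>\<psi> x - indicator C x\<bar> \<partial>lborel) \<le> 1 / real (Suc n)" for n \<psi>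
  have "\<exists>\<psi>. approx n \<psi>" for n
    unfolding approx_def
    by (rule mollified_indicator[OF C(1) bC \<Omega> clC, of "1 / real (Suc n)"]) (simp, blast)
  then obtain \<psi> where "\<And>n. approx n (\<psi> n)" by metis
  then have lip: "\<exists>L. L-lipschitz_on UNIV (\<psi> n)"
    and ex_G: "\<exists>G. (\<forall>x. GDERIV (\<psi> n) x :> G x) \<and> integrable lborel G
        \<and> ereal (\<integral>x. norm (G x) \<partial>lborel) \<le> perimeter C"
    and zero: "x \<notin> \<Omega> \<Longrightarrow> \<psi> n x = 0" and le1: "\<bar>\<psi> n x\<bar> \<le> 1"
    and meas: "\<psi> n \<in> borel_measurable borel"
    and int: "integrable lborel (\<lambda>x. \<psi> n x - indicator C x)"
    and L1: "(\<integral>x. \<bar>\<psi> n x - indicator C x\<bar> \<partial>lborel) \<le> 1 / real (Suc n)" for n x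
    unfolding approx_def by blast+
  have bound: "ereal \<bar>LINT x:\<Omega>|lebesgue. \<rho> x * \<psi> n x\<bar> \<le> ereal \<Lambda> * perimeter E" for n
  proof -
    obtain G where G: "\<And>x. GDERIV (\<psi> n) x :> G x" "integrable lborel G"
      "ereal (\<integral>x. norm (G x) \<partial>lborel) \<le> perimeter C"
      using ex_G by blast
    have test: "test_function \<Omega> (\<psi> n)"
      unfolding test_function_def lipschitz_fun_on_def
      using lip[of n] zero \<Omega> by (auto intro: lipschitz_on_subset simp: frontier_def interior_open)
    have iG: "integrable lebesgue (\<lambda>x. norm (G x))"
      using G(2) by (intro integrable_completion[THEN iffD2]) (auto dest: borel_measurable_integrable)
    have bi: "set_integrable lebesgue \<Omega> (\<lambda>x. norm (G x))"
      unfolding set_integrable_def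
      using \<Omega> by (intro integrable_mult_indicator iG) auto
    have "\<bar>LINT x:\<Omega>|lebesgue. \<rho> x * \<psi> n x\<bar> \<le> \<Lambda> * (LINT x:\<Omega>|lebesgue. norm (G x))"
      by (rule charge_le_displacement_times_variation[OF law u test bi]) (simp add: grad_eq[OF G(1)])
    also have "\<dots> \<le> \<Lambda> * (\<integral>x. norm (G x) \<partial>lebesgue)"
      unfolding set_lebesgue_integral_def
      by (intro mult_left_mono integral_mono_AE' iG max_displacement_nonneg[OF law])
        (auto simp: indicator_def)
    also have "(\<integral>x. norm (G x) \<partial>lebesgue) = (\<integral>x. norm (G x) \<partial>lborel)"
      using G(2) by (intro integral_completion) (auto dest: borel_measurable_integrable)
    finally have "ereal \<bar>LINT x:\<Omega>|lebesgue. \<rho> x * \<psi> n x\<bar> \<le> ereal \<Lambda> * ereal (\<integral>x. norm (G x) \<partial>lborel)"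
      by simp
    also have "\<dots> \<le> ereal \<Lambda> * perimeter E"
      using G(3) max_displacement_nonneg[OF law] by (intro ereal_mult_left_mono) (auto simp: per)
    finally show ?thesis .
  qed
  have "(\<lambda>n. \<integral>x. norm (\<psi> n x - indicator C x) \<partial>lborel) \<longlonglongrightarrow> 0"
  proof (rule tendsto_sandwich[OF _ _ tendsto_const lim_1_over_n[THEN LIMSEQ_Suc]])
    show "\<forall>\<^sub>F n in sequentially. 0 \<le> (\<integral>x. norm (\<psi> n x - indicator C x) \<partial>lborel)" by simp
    show "\<forall>\<^sub>F n in sequentially. (\<integral>x. norm (\<psi> n x - indicator C x) \<partial>lborel) \<le> 1 / real (Suc n)"
      using L1 by simp
  qed
  from tendsto_L1_AE_subseq[OF int this] obtain r :: "nat \<Rightarrow> nat"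
    where "AE x in lborel. (\<lambda>n. \<psi> (r n) x - indicator C x) \<longlonglongrightarrow> 0" by blast
  then have ae: "AE x in lebesgue. (\<lambda>n. \<psi> (r n) x - indicator C x) \<longlonglongrightarrow> 0" by (rule AE_completion)
  \<comment> \<open>The density is arbitrary outside \<Omega>; multiplied by the indicator it
    becomes integrable on the whole space.\<close>
  have \<rho>i: "integrable lebesgue (\<lambda>x. indicator \<Omega> x * \<rho> x)" using \<rho> by (simp add: set_integrable_def)
  then have \<rho>m: "(\<lambda>x. indicator \<Omega> x * \<rho> x) \<in> borel_measurable lebesgue" by (rule borel_measurable_integrable)
  have indC: "(indicator C :: 'a \<Rightarrow> real) \<in> borel_measurable lebesgue"
    using C(1) by (intro borel_measurable_imp_lebesgue) simp
  have "(\<lambda>n. \<integral>x. (indicator \<Omega> x * \<rho> x) * \<psi> (r n) x \<partial>lebesgue)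
      \<longlonglongrightarrow> (\<integral>x. (indicator \<Omega> x * \<rho> x) * indicator C x \<partial>lebesgue)"
  proof (rule integral_dominated_convergence[where w = "\<lambda>x. norm (indicator \<Omega> x * \<rho> x)"])
    show "(\<lambda>x. (indicator \<Omega> x * \<rho> x) * indicator C x) \<in> borel_measurable lebesgue"
      by (intro borel_measurable_times \<rho>m indC)
    show "(\<lambda>x. (indicator \<Omega> x * \<rho> x) * \<psi> (r n) x) \<in> borel_measurable lebesgue" for n
      using meas by (intro borel_measurable_times \<rho>m) (auto intro: borel_measurable_imp_lebesgue)
    show "integrable lebesgue (\<lambda>x. norm (indicator \<Omega> x * \<rho> x))"
      using \<rho>i by (rule integrable_norm)
    show "AE x in lebesgue. (\<lambda>n. (indicator \<Omega> x * \<rho> x) * \<psi> (r n) x) \<longlonglongrightarrow> (indicator \<Omega> x * \<rho> x) * indicator C x"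
      using ae by eventually_elim (intro tendsto_mult_left, simp add: LIM_zero_iff)
    show "AE x in lebesgue. norm ((indicator \<Omega> x * \<rho> x) * \<psi> (r n) x) \<le> norm (indicator \<Omega> x * \<rho> x)" for n
      unfolding real_norm_def abs_mult by (intro AE_I2 mult_left_le le1) simp
  qed
  moreover have "(\<integral>x. (indicator \<Omega> x * \<rho> x) * indicator C x \<partial>lebesgue) = (LINT x:E|lebesgue. \<rho> x)"
    unfolding set_lebesgue_integral_def
  proof (rule integral_cong_AE)
    show "(\<lambda>x. (indicator \<Omega> x * \<rho> x) * indicator C x) \<in> borel_measurable lebesgue"
      by (intro borel_measurable_times \<rho>m indC)
    have "(\<lambda>x. indicator E x *\<^sub>R \<rho> x) = (\<lambda>x. indicator E x * (indicator \<Omega> x * \<rho> x))"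
      using \<open>E \<subseteq> \<Omega>\<close> by (auto simp: fun_eq_iff indicator_def)
    then show "(\<lambda>x. indicator E x *\<^sub>R \<rho> x) \<in> borel_measurable lebesgue"
      using E(1) by (simp add: borel_measurable_times \<rho>m)
    show "AE x in lebesgue. (indicator \<Omega> x * \<rho> x) * indicator C x = indicator E x *\<^sub>R \<rho> x"
      using C(3) by eventually_elim (use \<open>E \<subseteq> \<Omega>\<close> in \<open>auto simp: indicator_def\<close>)
  qed
  ultimately have "(\<lambda>n. LINT x:\<Omega>|lebesgue. \<rho> x * \<psi> (r n) x) \<longlonglongrightarrow> (LINT x:E|lebesgue. \<rho> x)"
    by (simp add: set_lebesgue_integral_def mult.assoc)
  then have "(\<lambda>n. ereal \<bar>LINT x:\<Omega>|lebesgue. \<rho> x * \<psi> (r n) x\<bar>) \<longlonglongrightarrow> ereal \<bar>LINT x:E|lebesgue. \<rho> x\<bar>"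
    by (intro tendsto_intros)
  then show ?thesis
    by (rule LIMSEQ_le_const2) (use bound in blast)
qed

section \<open>Balls\<close>

text \<open>Bernoulli's inequality at \<open>- s\<close>. With \<open>n\<close> the dimension, the
  left side is the fraction of a ball's volume that lies within relative distance \<open>s\<close>
  of its sphere.\<close>

lemma one_minus_power_le:
  fixes s :: real
  assumes "0 \<le> s" "s \<le> 1"
  shows "1 - (1 - s) ^ n \<le> real n * s"
  using Bernoulli_inequality[of "- s" n] assms by simp

text \<open>With q = (1 - s) R, the radial cutoff gives c |B_q| \<le> \<Lambda> |B_R - B_q| / (s R).
  Division by |B_R| and Bernoulli's inequality yield c (1 - s)^N \<le> \<Lambda> N / R, and
  \<open>s\<close> tends to 0.\<close>

lemma uniform_density_le:
  fixes \<Omega> :: "'a::euclidean_space set"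
  assumes law: "admissible_coeffs a" "0 < \<sigma>" "max_displacement a \<sigma> = ereal \<Lambda>"
    and \<Omega>: "open \<Omega>" and u: "electrostatic_potential a \<sigma> \<Omega> \<rho> g u"
    and B: "0 < R" "ball x0 R \<subseteq> \<Omega>" and c: "0 \<le> c" "AE x\<in>ball x0 R in lebesgue. \<rho> x = c"
    and \<rho>: "set_integrable lebesgue \<Omega> \<rho>"
  shows "c \<le> real DIM('a) * \<Lambda> / R"
proof -
  let ?N = "DIM('a)"
  have annulus: "c * (1 - s) ^ ?N \<le> \<Lambda> * real ?N / R" if s: "0 < s" "s < 1" for s
  proof -
    define q where "q = (1 - s) * R"
    have q: "0 < q" "q < R" "R - q = s * R" using s B by (auto simp: q_def algebra_simps)
    have qN: "q ^ ?N = (1 - s) ^ ?N * R ^ ?N" by (simp add: q_def power_mult_distrib)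
    define \<psi> where "\<psi> x = max 0 (min 1 ((R - dist x0 x) / (s * R)))" for x
    \<comment> \<open>Closed ball minus open ball: the complement of \<open>A\<close> consists of
      two open sets on which \<psi> is constant, so its gradient vanishes there.\<close>
    define A where "A = cball x0 R - ball x0 q"
    have sR: "0 < s * R" using s B by simp
    have lip: "(1 / (s * R))-lipschitz_on UNIV \<psi>"
    proof (rule lipschitz_onI)
      fix x y
      have "\<bar>\<psi> x - \<psi> y\<bar> \<le> \<bar>(R - dist x0 x) / (s * R) - (R - dist x0 y) / (s * R)\<bar>"
        unfolding \<psi>_def by (simp add: max_def min_def)
      also have "\<dots> = \<bar>dist x0 y - dist x0 x\<bar> / (s * R)"
        using sR by (simp flip: diff_divide_distrib)
      also have "\<dots> \<le> dist x y / (s * R)"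
        using sR abs_dist_diff_le[of x x0 y] by (intro divide_right_mono) (auto simp: dist_commute)
      finally show "dist (\<psi> x) (\<psi> y) \<le> 1 / (s * R) * dist x y" by (simp add: dist_real_def)
    qed (use sR in simp)
    have \<psi>_out: "\<psi> x = 0" if "x \<notin> ball x0 R" for x
      using that sR by (simp add: \<psi>_def divide_nonpos_pos)
    have \<psi>_in: "\<psi> x = 1" if "x \<in> ball x0 q" for x
      using that sR q by (simp add: \<psi>_def)
    have \<psi>_nonneg: "0 \<le> \<psi> x" for x by (simp add: \<psi>_def)
    \<comment> \<open>The frontier of the open set \<Omega> is disjoint from \<Omega> and hence from
      the open ball, even if the closed ball touches it.\<close>
    have "\<psi> x = 0" if "x \<in> frontier \<Omega>" for x
      by (rule \<psi>_out) (use that B(2) \<Omega> in \<open>auto simp: frontier_def interior_open\<close>)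
    then have test: "test_function \<Omega> \<psi>"
      unfolding test_function_def lipschitz_fun_on_def
      using lip by (blast intro: lipschitz_on_subset)
    have grad: "norm (grad \<psi> x) \<le> indicator A x / (s * R)" for x
    proof -
      consider "x \<in> ball x0 q" | "x \<notin> cball x0 R" | "x \<in> A" by (auto simp: A_def)
      then show ?thesis
      proof cases
        case 1
        then show ?thesis using grad_locally_const[OF open_ball 1 \<psi>_in] sR by simp
      next
        case 2
        then have "grad \<psi> x = 0"
          using \<psi>_out by (intro grad_locally_const[of "- cball x0 R" _ _ 0]) auto
        then show ?thesis using sR by simp
      next
        case 3
        then show ?thesis using norm_grad_le_lipschitz[OF open_UNIV UNIV_I lip, of x] by simp
      qed
    qed
    have Am: "A \<in> sets borel" "bounded A"
      using bounded_subset[OF bounded_cball, of A x0 R] by (auto simp: A_def)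
    have Ai: "integrable lebesgue (\<lambda>x. indicator A x / (s * R) :: real)"
      using integrable_indicator_bounded[OF Am] Am
      by (intro integrable_divide) (subst integrable_completion, auto)
    have bi: "set_integrable lebesgue \<Omega> (\<lambda>x. indicator A x / (s * R))"
      unfolding set_integrable_def using \<Omega> by (intro integrable_mult_indicator Ai) auto
    have "(LINT x:\<Omega>|lebesgue. indicator A x / (s * R)) \<le> (\<integral>x. indicator A x / (s * R) \<partial>lebesgue)"
      unfolding set_lebesgue_integral_def using sR
      by (intro integral_mono_AE' Ai) (auto simp: indicator_def)
    also have "\<dots> = measure lborel A / (s * R)"
      using Am by simp
    also have "measure lborel A = measure lborel (cball x0 R) - measure lborel (ball x0 q)"
      unfolding A_def using q emeasure_lborel_cball_finite[of x0 R] by (intro measure_Diff) auto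
    also have "\<dots> = unit_ball_vol ?N * (R ^ ?N - q ^ ?N)"
      using q by (simp add: content_ball content_cball algebra_simps)
    finally have var: "(LINT x:\<Omega>|lebesgue. indicator A x / (s * R))
        \<le> unit_ball_vol ?N * (R ^ ?N - q ^ ?N) / (s * R)" .
    \<comment> \<open>The cutoff is 1 on the inner ball, and on the rest of the ball the integrand
      \<open>c * \<psi> x\<close> is nonnegative because \<open>c\<close> is.\<close>
    have "c * (unit_ball_vol ?N * q ^ ?N) = (\<integral>x. c * indicator (ball x0 q) x \<partial>lebesgue)"
      using q by (simp add: content_ball)
    also have "\<dots> \<le> (LINT x:\<Omega>|lebesgue. \<rho> x * \<psi> x)"
      unfolding set_lebesgue_integral_def
    proof (rule integral_mono_AE)
      show "integrable lebesgue (\<lambda>x. c * indicator (ball x0 q) x)"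
        using emeasure_lborel_ball_finite[of x0 q] by (intro integrable_mult_right) (simp add: integrable_indicator_iff)
      have "integrable lebesgue (\<lambda>x. \<psi> x * (indicator \<Omega> x *\<^sub>R \<rho> x))"
      proof (rule Bochner_Integration.integrable_bound)
        show "integrable lebesgue (\<lambda>x. indicator \<Omega> x *\<^sub>R \<rho> x)" using \<rho> by (simp add: set_integrable_def)
        then have "(\<lambda>x. indicator \<Omega> x *\<^sub>R \<rho> x) \<in> borel_measurable lebesgue" by (rule borel_measurable_integrable)
        moreover have "\<psi> \<in> borel_measurable lebesgue"
          by (intro borel_measurable_imp_lebesgue borel_measurable_continuous_onI lipschitz_on_continuous_on[OF lip])
        ultimately show "(\<lambda>x. \<psi> x * (indicator \<Omega> x *\<^sub>R \<rho> x)) \<in> borel_measurable lebesgue"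
          by (intro borel_measurable_times)
        have "\<bar>\<psi> x\<bar> \<le> 1" for x by (simp add: \<psi>_def)
        then show "AE x in lebesgue. norm (\<psi> x * (indicator \<Omega> x *\<^sub>R \<rho> x)) \<le> norm (indicator \<Omega> x *\<^sub>R \<rho> x)"
          unfolding real_norm_def abs_mult by (intro AE_I2 mult_left_le_one_le) auto
      qed
      then show "integrable lebesgue (\<lambda>x. indicator \<Omega> x *\<^sub>R (\<rho> x * \<psi> x))" by (simp add: ac_simps)
      show "AE x in lebesgue. c * indicator (ball x0 q) x \<le> indicator \<Omega> x *\<^sub>R (\<rho> x * \<psi> x)"
        using c(2)
      proof eventually_elim
        fix x assume x: "x \<in> ball x0 R \<longrightarrow> \<rho> x = c"
        show "c * indicator (ball x0 q) x \<le> indicator \<Omega> x *\<^sub>R (\<rho> x * \<psi> x)"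
        proof (cases "x \<in> ball x0 R")
          case True
          then show ?thesis using x B(2) c(1) \<psi>_in[of x] \<psi>_nonneg[of x] by (auto simp: indicator_def)
        next
          case False
          then show ?thesis using \<psi>_out q by (simp add: indicator_def)
        qed
      qed
    qed
    also have "\<dots> \<le> \<Lambda> * (LINT x:\<Omega>|lebesgue. indicator A x / (s * R))"
      using charge_le_displacement_times_variation[OF law u test bi] grad by (simp add: abs_le_iff)
    also have "\<dots> \<le> \<Lambda> * (unit_ball_vol ?N * (R ^ ?N - q ^ ?N) / (s * R))"
      by (intro mult_left_mono var max_displacement_nonneg[OF law])
    also have "\<dots> = unit_ball_vol ?N * R ^ ?N * (\<Lambda> * (1 - (1 - s) ^ ?N) / (s * R))"
      unfolding qN using sR by (simp add: field_simps)
    also have "\<dots> \<le> unit_ball_vol ?N * R ^ ?N * (\<Lambda> * (real ?N * s) / (s * R))"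
      using sR s B max_displacement_nonneg[OF law]
      by (intro mult_left_mono divide_right_mono one_minus_power_le mult_nonneg_nonneg) auto
    finally have "(unit_ball_vol ?N * R ^ ?N) * (c * (1 - s) ^ ?N) \<le> (unit_ball_vol ?N * R ^ ?N) * (\<Lambda> * real ?N / R)"
      using s B by (simp add: qN ac_simps)
    then show ?thesis
      by (rule mult_left_le_imp_le) (use B(1) in simp)
  qed
  have "((\<lambda>s. c * (1 - s) ^ ?N) \<longlongrightarrow> c * (1 - 0) ^ ?N) (at_right 0)"
    by (intro tendsto_intros)
  then have "c * (1 - 0) ^ ?N \<le> \<Lambda> * real ?N / R"
  proof (rule tendsto_upperbound)
    show "\<forall>\<^sub>F s in at_right 0. c * (1 - s) ^ ?N \<le> \<Lambda> * real ?N / R"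
      using eventually_at_right_less[of "0::real"] eventually_at_right_real[of 0 1, simplified]
      by eventually_elim (use annulus in auto)
  qed simp
  then show ?thesis by (simp add: mult.commute)
qed

text \<open>An even kernel has vanishing first moment, so mollification reproduces affine maps. From
  a point of the ball of radius \<open>R\<close> the kernel reaches only points of the ball of
  radius \<open>R + \<epsilon>\<close>, so the truncation is not seen.\<close>

lemma (in mollifier) conv_linear_on_ball:
  assumes "norm (x - x0) < R"
  shows "conv (\<lambda>y. indicator (ball x0 (R + \<epsilon>)) y *\<^sub>R (y - x0)) x = x - x0"
proof -
  have "integrable lborel (\<lambda>z. k z *\<^sub>R z)"
  proof (rule integrable_bounded_support[OF _ bounded_ball[of 0 \<epsilon>]])
    show "norm (k z *\<^sub>R z) \<le> L * \<epsilon>" for z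
      using k_nonneg[of z] k_le[of z] k_eq_0[of z] eps_pos L_nonneg
      by (cases "norm z < \<epsilon>") (auto intro!: mult_mono)
  qed (use k_eq_0 in auto)
  then have kz: "integrable lborel (\<lambda>y. k (x - y) *\<^sub>R (x - y))"
    and shift: "(\<integral>y. k (x - y) *\<^sub>R (x - y) \<partial>lborel) = (\<integral>z. k z *\<^sub>R z \<partial>lborel)"
    using lborel_integral_reflect[of "\<lambda>z. k z *\<^sub>R z" x]
      integrable_distr[of "\<lambda>y. x - y" lborel lborel "\<lambda>z. k z *\<^sub>R z"] lborel_distr_reflect[of x]
    by (simp_all cong: distr_cong)
  have "(\<integral>z. k z *\<^sub>R z \<partial>lborel) = - (\<integral>z. k z *\<^sub>R z \<partial>lborel)"
    using lborel_integral_reflect[of "\<lambda>z. k z *\<^sub>R z" 0] by (simp add: k_even)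
  then have "2 *\<^sub>R (\<integral>z. k z *\<^sub>R z \<partial>lborel) = 0"
    unfolding scaleR_2 by (simp only: eq_neg_iff_add_eq_0)
  then have "(\<integral>z. k z *\<^sub>R z \<partial>lborel) = 0" by simp
  then have zero: "(\<integral>y. k (x - y) *\<^sub>R (x - y) \<partial>lborel) = 0" using shift by simp
  have "k (x - y) *\<^sub>R (indicator (ball x0 (R + \<epsilon>)) y *\<^sub>R (y - x0))
      = k (x - y) *\<^sub>R (x - x0) - k (x - y) *\<^sub>R (x - y)" for y
  proof (cases "norm (x - y) < \<epsilon>")
    case True
    then have "y \<in> ball x0 (R + \<epsilon>)"
      using assms norm_triangle_ineq[of "y - x" "x - x0"] by (simp add: dist_norm norm_minus_commute)
    then show ?thesis by (simp flip: scaleR_diff_right)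
  qed (simp add: k_eq_0)
  then have "conv (\<lambda>y. indicator (ball x0 (R + \<epsilon>)) y *\<^sub>R (y - x0)) x
      = (\<integral>y. k (x - y) *\<^sub>R (x - x0) - k (x - y) *\<^sub>R (x - y) \<partial>lborel)"
    unfolding conv_def by simp
  also have "\<dots> = (\<integral>y. k (x - y) *\<^sub>R (x - x0) \<partial>lborel)"
    using kz zero k_reflect_integrable[of x] by simp
  also have "\<dots> = x - x0"
    using k_reflect_integrable[of x] by (simp add: k_reflect_integral)
  finally show ?thesis .
qed

text \<open>Multiplied by the volume of the ball, the density bound has right-hand side \<Lambda> N
  |B_R| / R; this estimate turns it into \<Lambda> times the perimeter.\<close>

lemma perimeter_ball_ge:
  fixes x0 :: "'a::euclidean_space"
  assumes R: "0 < R"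
  shows "ereal (real DIM('a) * measure lborel (ball x0 R) / R) \<le> perimeter (ball x0 R)"
proof -
  let ?N = "real DIM('a)" and ?V = "measure lborel (ball x0 R)"
  have approx: "ereal (?N * ?V / (R + e)) \<le> perimeter (ball x0 R)" if e: "0 < e" for e
  proof -
    obtain k and g :: "'a \<Rightarrow> 'a" and L where "mollifier e k g L" using mollifier_exists[OF e] .
    then interpret mollifier e k g L .
    \<comment> \<open>The field extends to radius \<open>R + e\<close> so that its mollification is
      linear on the ball of radius \<open>R\<close>; division by \<open>R + e\<close> instead of
      \<open>R\<close> keeps its norm at most 1.\<close>
    define f where "f y = (1 / (R + e)) *\<^sub>R (indicator (ball x0 (R + e)) y *\<^sub>R (y - x0))" for y
    have f0: "f y = 0" if "y \<notin> ball x0 (R + e)" for y using that by (simp add: f_def)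
    have f1: "norm (f y) \<le> 1" for y
      using R e by (simp add: f_def indicator_def dist_norm norm_minus_commute divide_le_eq)
    have [measurable]: "ball x0 (R + e) \<in> sets borel" by simp
    have "f \<in> borel_measurable borel"
      unfolding f_def[abs_def] by measurable
    then have fi: "integrable lborel f"
      by (rule integrable_bounded_support[OF _ bounded_ball f0 f1])
    have conv: "conv f x = (1 / (R + e)) *\<^sub>R (x - x0)" if "x \<in> ball x0 R" for x
    proof -
      have "conv f x = (1 / (R + e)) *\<^sub>R conv (\<lambda>y. indicator (ball x0 (R + e)) y *\<^sub>R (y - x0)) x"
        unfolding conv_def f_def by (subst integral_scaleR_right[symmetric]) (simp add: ac_simps)
      then show ?thesis
        using conv_linear_on_ball[of x x0 R] that by (simp add: dist_norm norm_minus_commute)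
    qed
    have div: "divergence (conv f) x = ?N / (R + e)" if x: "x \<in> ball x0 R" for x
    proof -
      have "((\<lambda>x. (1 / (R + e)) *\<^sub>R (x - x0)) has_derivative (\<lambda>h. (1 / (R + e)) *\<^sub>R h)) (at x)"
        by (auto intro!: derivative_eq_intros)
      then have "(conv f has_derivative (\<lambda>h. (1 / (R + e)) *\<^sub>R h)) (at x)"
        by (rule has_derivative_transform_within_open[OF _ open_ball x]) (simp add: conv)
      then show ?thesis
        unfolding divergence_def by (simp flip: frechet_derivative_at)
    qed
    have C1: "C1_compact_support (conv f)"
      by (rule conv_C1_compact_support[OF fi bounded_ball f0])
    have "(LINT x:ball x0 R|lebesgue. divergence (conv f) x)
        = (\<integral>x. indicator (ball x0 R) x * divergence (conv f) x \<partial>lborel)"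
      by (intro set_lebesgue_integral_lborel divergence_measurable C1) simp
    also have "\<dots> = (\<integral>x. indicator (ball x0 R) x * (?N / (R + e)) \<partial>lborel)"
      by (intro Bochner_Integration.integral_cong refl) (simp add: indicator_def div)
    also have "\<dots> = ?N * ?V / (R + e)" by simp
    finally have "ereal (?N * ?V / (R + e)) = ereal (LINT x:ball x0 R|lebesgue. divergence (conv f) x)"
      by simp
    also have "\<dots> \<le> perimeter (ball x0 R)"
      unfolding perimeter_def using C1 norm_conv_le[OF fi f1] by (intro SUP_upper) blast
    finally show ?thesis .
  qed
  have "((\<lambda>e. ereal (?N * ?V / (R + e))) \<longlongrightarrow> ereal (?N * ?V / (R + 0))) (at_right 0)"
    using R by (intro tendsto_intros) auto
  then have "ereal (?N * ?V / (R + 0)) \<le> perimeter (ball x0 R)"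
  proof (rule tendsto_upperbound)
    show "\<forall>\<^sub>F e in at_right 0. ereal (?N * ?V / (R + e)) \<le> perimeter (ball x0 R)"
      using eventually_at_right_less[of "0::real"] by eventually_elim (rule approx)
  qed simp
  then show ?thesis by simp
qed

section \<open>The charge bounds for compactly contained sets and for balls\<close>

theorem corollary8p1:
  fixes \<Omega> :: "'a::euclidean_space set"
    and a :: "nat \<Rightarrow> real"
    and \<sigma> \<Lambda> :: real
    and \<rho> :: "'a \<Rightarrow> real"
  assumes "bounded_lipschitz_domain \<Omega>"
    and "admissible_coeffs a"
    and "0 < \<sigma>"
    and "max_field_strength a = ereal \<sigma>"
    and "max_displacement a \<sigma> = ereal \<Lambda>"
    and "set_integrable lebesgue \<Omega> \<rho>"
    and "admissible_density a \<sigma> \<Omega> \<rho>"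
  shows "(\<forall>E. finite_perimeter E \<and> compactly_contained E \<Omega> \<longrightarrow>
            ereal \<bar>LINT x:E|lebesgue. \<rho> x\<bar> \<le> ereal \<Lambda> * perimeter E) \<and>
         (\<forall>x0 R c. 0 < R \<and> ball x0 R \<subseteq> \<Omega> \<and> 0 \<le> c \<and> (AE x\<in>ball x0 R in lebesgue. \<rho> x = c) \<longrightarrow>
            c \<le> real DIM('a) * \<Lambda> / R \<and>
            ereal (LINT x:ball x0 R|lebesgue. \<rho> x) \<le> ereal \<Lambda> * perimeter (ball x0 R))"
proof -
  have \<Omega>: "open \<Omega>" using assms(1) by (simp add: bounded_lipschitz_domain_def)
  obtain g u where u: "electrostatic_potential a \<sigma> \<Omega> \<rho> g u"
    using assms(7) unfolding admissible_density_def by blast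
  note law = assms(2,3,5)
  have "c \<le> real DIM('a) * \<Lambda> / R \<and>
      ereal (LINT x:ball x0 R|lebesgue. \<rho> x) \<le> ereal \<Lambda> * perimeter (ball x0 R)"
    if B: "0 < R" "ball x0 R \<subseteq> \<Omega>" and c: "0 \<le> c" "AE x\<in>ball x0 R in lebesgue. \<rho> x = c" for x0 R c
  \<comment> \<open>The ball may touch the frontier of \<Omega>, so the bound for compactly
    contained sets does not cover it. Its charge is \<open>c\<close> times its volume, and the
    density bound is combined with \<open>perimeter_ball_ge\<close>.\<close>
  proof
    let ?V = "measure lborel (ball x0 R)"
    show le: "c \<le> real DIM('a) * \<Lambda> / R"
      by (rule uniform_density_le[OF law \<Omega> u B c assms(6)])
    have meas: "(\<lambda>x. indicator (ball x0 R) x *\<^sub>R \<rho> x) \<in> borel_measurable lebesgue"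
    proof -
      have "(\<lambda>x. indicator (ball x0 R) x *\<^sub>R \<rho> x) = (\<lambda>x. indicator (ball x0 R) x * (indicator \<Omega> x *\<^sub>R \<rho> x))"
        using B(2) by (auto simp: fun_eq_iff indicator_def)
      moreover have "(\<lambda>x. indicator \<Omega> x *\<^sub>R \<rho> x) \<in> borel_measurable lebesgue"
        using assms(6) unfolding set_integrable_def by (rule borel_measurable_integrable)
      moreover have "(indicator (ball x0 R) :: 'a \<Rightarrow> real) \<in> borel_measurable lebesgue"
        by (intro borel_measurable_imp_lebesgue borel_measurable_indicator borel_open open_ball)
      ultimately show ?thesis by (simp only: borel_measurable_times)
    qed
    have "(LINT x:ball x0 R|lebesgue. \<rho> x) = (\<integral>x. indicator (ball x0 R) x * c \<partial>lebesgue)"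
      unfolding set_lebesgue_integral_def
    proof (rule integral_cong_AE[OF meas])
      show "(\<lambda>x. indicator (ball x0 R) x * c) \<in> borel_measurable lebesgue"
        by (intro borel_measurable_imp_lebesgue borel_measurable_times borel_measurable_const
            borel_measurable_indicator borel_open open_ball)
      show "AE x in lebesgue. indicator (ball x0 R) x *\<^sub>R \<rho> x = indicator (ball x0 R) x * c"
        using c(2) by eventually_elim (auto simp: indicator_def)
    qed
    also have "\<dots> = c * ?V" by simp
    also have "\<dots> \<le> real DIM('a) * \<Lambda> / R * ?V"
      using le by (intro mult_right_mono) auto
    finally have "ereal (LINT x:ball x0 R|lebesgue. \<rho> x) \<le> ereal \<Lambda> * ereal (real DIM('a) * ?V / R)"
      by (simp add: ac_simps)
    also have "\<dots> \<le> ereal \<Lambda> * perimeter (ball x0 R)"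
      using max_displacement_nonneg[OF law] by (intro ereal_mult_left_mono perimeter_ball_ge B) auto
    finally show "ereal (LINT x:ball x0 R|lebesgue. \<rho> x) \<le> ereal \<Lambda> * perimeter (ball x0 R)" .
  qed
  moreover have "ereal \<bar>LINT x:E|lebesgue. \<rho> x\<bar> \<le> ereal \<Lambda> * perimeter E"
    if "finite_perimeter E" "compactly_contained E \<Omega>" for E
    using that charge_le_displacement_times_perimeter[OF law \<Omega> assms(6) u]
    unfolding finite_perimeter_def by blast
  ultimately show ?thesis by blast
qed

end
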